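(* Let $\mathcal{K}$ be a non-degenerate coronoid with coronoid graph $G=G(\mathcal{K})$, and let $C$ be one of its perimeters, with binary boundary code $\mathit{BBC}(C)=2\,3^{\ell_1}\,2\,3^{\ell_2}\,2\cdots 2\,3^{\ell_d}$, where $\ell_i\ge 0$ for $i=1,\dots,d$. In the altan $A(G,C)$, for $1\le i\le d$ the $i$-th newly obtained face (the face bounded by the spokes at the $i$-th and $(i+1)$-th degree-2 vertices of $C$, indices modulo $d$, where the $i$-th degree-2 vertex is the $2$ immediately preceding the block $3^{\ell_i}$) has degree $\ell_i+5$. Moreover, the binary boundary code of the new boundary cycle is $(32)^d$.
   Context: Let $\mathcal{H}$ be the set of hexagons of the regular hexagonal tiling of the plane; two hexagons are adjacent if distinct and sharing an edge; a hexagonal system is a subset of $\mathcal{H}$; it is connected if non-empty and any two of its hexagons are joined by a sequence of its hexagons with consecutive ones adjacent. A coronoid is a finite connected hexagonal system $\mathcal{K}$; its corona holes are the finite connected components of $\mathcal{H}\setminus\mathcal{K}$; it is non-degenerate if no corona hole consists of a single hexagon. $G(\mathcal{K})$ is the subgraph of the hexagonal lattice consisting of all vertices and edges lying on some hexagon of $\mathcal{K}$. An edge of $G(\mathcal{K})$ is a boundary edge if it lies on exactly one hexagon of $\mathcal{K}$; a vertex is internal if incident with three edges each lying on two hexagons of $\mathcal{K}$, otherwise boundary. The boundary vertices and edges form disjoint cycles, the perimeters. The binary boundary code of a perimeter is the cyclic sequence of degrees in $G(\mathcal{K})$ of consecutive vertices along it (defined up to cyclic shift and reversal); $3^k$ denotes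 $k$ consecutive 3's. The altan $A(G,C)$: if $v_1,\dots,v_d$ are the degree-2 vertices of $C$ in cyclic order, add a new cycle $w_1x_1w_2x_2\cdots w_dx_dw_1$ on $2d$ new vertices and the spokes $v_iw_i$, the new cycle drawn in the hole bounded by $C$; the degrees in the new boundary code are taken in $A(G,C)$. *)

theory Defs
  imports "HOL-Library.Product_Plus" "HOL-Combinatorics.Orbits"
begin

section \<open>Finite simple graphs and plane rotation systems\<close>

type_synonym 'v graph = "'v set \<times> 'v set set"

abbreviation verts :: "'v graph \<Rightarrow> 'v set" where "verts \<equiv> fst"
abbreviation edges :: "'v graph \<Rightarrow> 'v set set" where "edges \<equiv> snd"

definition degree :: "'v graph \<Rightarrow> 'v \<Rightarrow> nat" where
  "degree G v = card {e \<in> edges G. v \<in> e}"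

text \<open>A cycle is given by one of its traversals: its vertices, listed in cyclic order from an
  arbitrary start and in an arbitrary direction.\<close>

definition is_cycle :: "'v graph \<Rightarrow> 'v list \<Rightarrow> bool" where
  "is_cycle G c \<longleftrightarrow> 3 \<le> length c \<and> distinct c \<and> set c \<subseteq> verts G \<and>
     (\<forall>i<length c. {c ! i, c ! (Suc i mod length c)} \<in> edges G)"

text \<open>The cyclic successor of an element \<open>y\<close> of a list with distinct entries.\<close>

definition cyc_next :: "'a list \<Rightarrow> 'a \<Rightarrow> 'a" where
  "cyc_next xs y = hd (tl (dropWhile (\<lambda>x. x \<noteq> y) (xs @ xs)))"

text \<open>A graph drawn in the plane is described by its rotation system, which gives for each vertex
  the list of its neighbours in counterclockwise order.  A face is the set of directed edges
  having that face on their right-hand side: the directed edge following \<open>(u, v)\<close> on the boundary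
  of its face leads from \<open>v\<close> to the neighbour next to \<open>u\<close> counterclockwise.  An edge with the same
  face on both sides is counted twice in the degree of the face.\<close>

type_synonym 'v rotation = "'v \<Rightarrow> 'v list"

definition darts :: "'v graph \<Rightarrow> ('v \<times> 'v) set" where
  "darts G = {(u, v). u \<noteq> v \<and> {u, v} \<in> edges G}"

definition face_step :: "'v rotation \<Rightarrow> 'v \<times> 'v \<Rightarrow> 'v \<times> 'v" where
  "face_step R = (\<lambda>(u, v). (v, cyc_next (R v) u))"

definition faces :: "'v graph \<Rightarrow> 'v rotation \<Rightarrow> ('v \<times> 'v) set set" where
  "faces G R = orbit (face_step R) ` darts G"

definition face_edges :: "('v \<times> 'v) set \<Rightarrow> 'v set set" where
  "face_edges F = (\<lambda>(u, v). {u, v}) ` F"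

definition face_degree :: "('v \<times> 'v) set \<Rightarrow> nat" where
  "face_degree F = card F"


section \<open>The hexagonal tiling\<close>

text \<open>The pair \<open>(a, b)\<close> stands for the point \<open>a + b\<omega>\<close> of the plane, \<open>\<omega> = exp (2\<pi>i/3)\<close>.  The
  centres of the hexagons of the tiling are the points with \<open>a + b\<close> divisible by 3, its vertices
  are the other points, and its edges have length 1.  A hexagon is identified with its centre.\<close>

type_synonym point = "int \<times> int"

text \<open>Multiplication by \<open>\<zeta> = exp (\<pi>i/3) = 1 + \<omega>\<close> and by \<open>\<omega>\<close>, that is, counterclockwise rotation by
  60 and by 120 degrees.\<close>

definition mult_zeta :: "point \<Rightarrow> point" where
  "mult_zeta = (\<lambda>(a, b). (a - b, a))"

definition mult_omega :: "point \<Rightarrow> point" where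
  "mult_omega = (\<lambda>(a, b). (- b, a - b))"

definition units :: "point set" where
  "units = {(1, 0), (1, 1), (0, 1), (-1, 0), (-1, -1), (0, -1)}"

definition hexagons :: "point set" where
  "hexagons = {(a, b). 3 dvd a + b}"

definition corners :: "point \<Rightarrow> point set" where
  "corners h = (\<lambda>e. h + e) ` units"

definition hex_edges :: "point \<Rightarrow> point set set" where
  "hex_edges h = (\<lambda>e. {h + e, h + mult_zeta e}) ` units"

definition hex_adj :: "point \<Rightarrow> point \<Rightarrow> bool" where
  "hex_adj h h' \<longleftrightarrow> h \<noteq> h' \<and> hex_edges h \<inter> hex_edges h' \<noteq> {}"

text \<open>The three neighbours, in counterclockwise order, of a vertex in the whole lattice.\<close>

definition lattice_nbrs :: "point \<Rightarrow> point list" where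
  "lattice_nbrs v =
     (let e = (if (fst v + snd v) mod 3 = 1 then (1, 0) else (-1, 0))
      in [v + e, v + mult_omega e, v + mult_omega (mult_omega e)])"


section \<open>Coronoids\<close>

definition hex_connected :: "point set \<Rightarrow> bool" where
  "hex_connected S \<longleftrightarrow> S \<noteq> {} \<and>
     (\<forall>h\<in>S. \<forall>h'\<in>S. (h, h') \<in> {(a, b). a \<in> S \<and> b \<in> S \<and> hex_adj a b}\<^sup>*)"

definition hex_components :: "point set \<Rightarrow> point set set" where
  "hex_components S = {D. D \<subseteq> S \<and> hex_connected D \<and>
     (\<forall>D'. D \<subseteq> D' \<and> D' \<subseteq> S \<and> hex_connected D' \<longrightarrow> D' = D)}"

definition coronoid :: "point set \<Rightarrow> bool" where
  "coronoid K \<longleftrightarrow> K \<subseteq> hexagons \<and> finite K \<and> hex_connected K"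

definition corona_holes :: "point set \<Rightarrow> point set set" where
  "corona_holes K = {D \<in> hex_components (hexagons - K). finite D}"

definition nondegenerate :: "point set \<Rightarrow> bool" where
  "nondegenerate K \<longleftrightarrow> (\<forall>D \<in> corona_holes K. card D \<noteq> 1)"

definition coronoid_graph :: "point set \<Rightarrow> point graph" where
  "coronoid_graph K = ((\<Union>h\<in>K. corners h), (\<Union>h\<in>K. hex_edges h))"

text \<open>The number of hexagons of \<open>K\<close> on which an edge lies.\<close>

definition edge_mult :: "point set \<Rightarrow> point set \<Rightarrow> nat" where
  "edge_mult K e = card {h \<in> K. e \<in> hex_edges h}"

definition internal_vertices :: "point set \<Rightarrow> point set" where
  "internal_vertices K = {v \<in> verts (coronoid_graph K).
     card {e \<in> edges (coronoid_graph K). v \<in> e \<and> edge_mult K e = 2} = 3}"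

definition boundary_graph :: "point set \<Rightarrow> point graph" where
  "boundary_graph K = (verts (coronoid_graph K) - internal_vertices K,
                       {e \<in> edges (coronoid_graph K). edge_mult K e = 1})"

definition perimeter :: "point set \<Rightarrow> point list \<Rightarrow> bool" where
  "perimeter K c \<longleftrightarrow> is_cycle (boundary_graph K) c"


section \<open>Boundary codes\<close>

text \<open>A cyclic sequence, up to reversal, is the set of all its linear readings.\<close>

definition cyclic_code :: "nat list \<Rightarrow> nat list set" where
  "cyclic_code s = {t. \<exists>n. t = rotate n s \<or> t = rotate n (rev s)}"

definition degree_sequence :: "'v graph \<Rightarrow> 'v list \<Rightarrow> nat list" where
  "degree_sequence G c = map (degree G) c"

definition bbc :: "'v graph \<Rightarrow> 'v list \<Rightarrow> nat list set" where
  "bbc G c = cyclic_code (degree_sequence G c)"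


section \<open>Altans\<close>

datatype 'v altan_vertex = Old 'v | W nat | X nat

text \<open>The indices of \<open>v\<^sub>i\<close>, \<open>w\<^sub>i\<close> and \<open>x\<^sub>i\<close> run from 0 to \<open>d - 1\<close>.\<close>

definition deg2_vertices :: "'v graph \<Rightarrow> 'v list \<Rightarrow> 'v list" where
  "deg2_vertices G c = filter (\<lambda>v. degree G v = 2) c"

definition spoke :: "'v graph \<Rightarrow> 'v list \<Rightarrow> nat \<Rightarrow> 'v altan_vertex set" where
  "spoke G c i = {Old (deg2_vertices G c ! i), W i}"

definition altan :: "'v graph \<Rightarrow> 'v list \<Rightarrow> 'v altan_vertex graph" where
  "altan G c = (let d = length (deg2_vertices G c) in
     (Old ` verts G \<union> W ` {..<d} \<union> X ` {..<d},
      (\<lambda>e. Old ` e) ` edges G \<union>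
      spoke G c ` {..<d} \<union>
      (\<lambda>i. {W i, X i}) ` {..<d} \<union>
      (\<lambda>i. {X i, W (Suc i mod d)}) ` {..<d}))"

definition altan_new_cycle :: "'v graph \<Rightarrow> 'v list \<Rightarrow> 'v altan_vertex list" where
  "altan_new_cycle G c = concat (map (\<lambda>i. [W i, X i]) [0..<length (deg2_vertices G c)])"

text \<open>The region bounded by the perimeter \<open>c\<close> and not containing its incident hexagons of \<open>K\<close>
  (a corona hole or the exterior) is to the left of the traversal \<open>c\<close>.  The point
  \<open>v + \<zeta>(u - v)\<close> is the centre of the hexagon to the left of the directed edge \<open>(v, u)\<close>.\<close>

definition hole_on_left :: "point set \<Rightarrow> point list \<Rightarrow> bool" where
  "hole_on_left K c \<longleftrightarrow> (\<forall>v \<in> set c. v + mult_zeta (cyc_next c v - v) \<notin> K)"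

text \<open>The drawing of the altan: the coronoid graph is drawn as in the lattice, with the new cycle
  in the hole bounded by \<open>c\<close>.  The spoke at \<open>v\<^sub>i\<close> takes the place of the only lattice edge at
  \<open>v\<^sub>i\<close> missing from the coronoid graph; that edge points into the hole.  Seen from the hole,
  the order of \<open>x\<^sub>i\<close>, \<open>v\<^sub>i\<close>, \<open>x\<^sub>i\<^sub>-\<^sub>1\<close> around \<open>w\<^sub>i\<close> depends on the direction of the traversal
  \<open>c\<close>.\<close>

fun altan_rotation :: "point set \<Rightarrow> point list \<Rightarrow> point altan_vertex rotation" where
  "altan_rotation K c (Old v) =
     (let G = coronoid_graph K; vs = deg2_vertices G c in
      concat (map (\<lambda>u. if {v, u} \<in> edges G then [Old u]
                       else map W (filter (\<lambda>i. vs ! i = v) [0..<length vs]))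
                  (lattice_nbrs v)))"
| "altan_rotation K c (W i) =
     (let vs = deg2_vertices (coronoid_graph K) c; d = length vs in
      if hole_on_left K c then [X i, X ((i + d - 1) mod d), Old (vs ! i)]
      else [X i, Old (vs ! i), X ((i + d - 1) mod d)])"
| "altan_rotation K c (X i) =
     (let d = length (deg2_vertices (coronoid_graph K) c) in [W i, W (Suc i mod d)])"

text \<open>The face bounded by the \<open>i\<close>-th and the next spoke.  For \<open>d = 2\<close> the two spokes alone would
  not distinguish the two new faces, whence the path \<open>w\<^sub>i x\<^sub>i w\<^sub>i\<^sub>+\<^sub>1\<close> in the definition.\<close>

definition is_new_face ::
  "point set \<Rightarrow> point list \<Rightarrow> nat \<Rightarrow> (point altan_vertex \<times> point altan_vertex) set \<Rightarrow> bool" where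
  "is_new_face K c i F \<longleftrightarrow>
     (let G = coronoid_graph K; j = Suc i mod length (deg2_vertices G c) in
      F \<in> faces (altan G c) (altan_rotation K c) \<and>
      {spoke G c i, spoke G c j, {W i, X i}, {X i, W j}} \<subseteq> face_edges F)"

end

(*
The hexagonal lattice around a boundary vertex v of a perimeter shows that the side on which the hole
lies does not change along the perimeter, and that the perimeter turns one way at the vertices of
degree 3 and the other way, with the missing lattice edge on the side of the hole, at the vertices
of degree 2.  A perimeter with a single vertex of degree 2 would turn the same way at all other
vertices; six such turns close up around a hexagon, and shorter walks do not close up at all.
Hence there are at least two spokes, the new cycle is a genuine cycle, and tracing faces gives the
vertex cycle v_i, ..., v_{i+1}, w_{i+1}, x_i, w_i, of length (l_i + 1) + 4.  The only other face
along the new cycle consists of edges of the new cycle and so contains no spoke.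
*)
theory Submission
  imports Defs
begin

section \<open>The hexagonal lattice\<close>

text \<open>The direction of the traversal is free, so the hole may lie on either side, whereas
  \<open>face_step\<close> always keeps faces on the right. The flag in \<open>turn\<close> and
  \<open>orient\<close> absorbs this: every local fact is stated once along the traversal, and under
  \<open>hole_on_left\<close> the orbit simply runs against it.

  A single spoke has to be excluded because the edges \<open>{w, x}\<close> and
  \<open>{x, w}\<close> would coincide, so that x would have degree 1 and a repeated entry in its
  rotation list. The six in that argument is the order of \<zeta>: a constantly turning walk has the
  edges \<zeta>^k e (or their mirror images), and the sixth roots of unity sum to zero.

  A face degree counts darts, so the length of the traced walk is the degree only if its vertices
  are distinct. This again uses two spokes: otherwise the path from \<open>v_i\<close> to
  \<open>v_{i+1}\<close> would return to its start. That a face is determined by any one of its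
  darts rests on \<open>face_step\<close> permuting the finite set of darts.\<close>

lemma mult_omega_units: "e \<in> units \<Longrightarrow> mult_omega e \<in> units"
  by (auto simp: units_def mult_omega_def)

lemma mult_zeta_units: "e \<in> units \<Longrightarrow> mult_zeta e \<in> units"
  by (auto simp: units_def mult_zeta_def)

text \<open>The two solutions are the centres to the left and to the right of the directed edge,
  because -\<omega> = \<zeta>^5 is the inverse of \<zeta>.\<close>

lemma mem_hex_edges_iff:
  assumes "e \<in> units"
  shows "{v, v + e} \<in> hex_edges h \<longleftrightarrow> h = v + mult_zeta e \<or> h = v - mult_omega e"
proof -
  \<comment> \<open>The unit \<open>x\<close> points to the end of the side that comes first
    counterclockwise around \<open>h\<close>: \<zeta>^4 e for the left hexagon, \<zeta> e for the
    right one.\<close>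
  have edge_eq: "{v, v + e} = {h + x, h + mult_zeta x} \<longleftrightarrow>
      x = mult_omega (mult_omega e) \<and> h = v + mult_zeta e \<or>
      x = mult_zeta e \<and> h = v - mult_omega e" for x
    by (cases v; cases h; cases e; cases x)
      (simp only: doubleton_eq_iff mult_zeta_def mult_omega_def prod.case
        add_Pair diff_Pair prod.inject; arith)
  show ?thesis
    unfolding hex_edges_def image_iff edge_eq
    using assms mult_omega_units mult_zeta_units by blast
qed

lemma hex_edge_through:
  assumes "E \<in> hex_edges h" "v \<in> E"
  obtains e where "e \<in> units" "E = {v, v + e}"
proof -
  obtain x where x: "x \<in> units" "E = {h + x, h + mult_zeta x}"
    using assms by (auto simp: hex_edges_def)
  have "mult_zeta x - x \<in> units" "x - mult_zeta x \<in> units"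
    using x by (auto simp: units_def mult_zeta_def)
  moreover have "E = {v, v + (mult_zeta x - x)} \<or> E = {v, v + (x - mult_zeta x)}"
    using x assms(2) by (auto simp: algebra_simps)
  ultimately show thesis using that by blast
qed

lemma coronoid_edge_iff:
  assumes "e \<in> units"
  shows "{v, v + e} \<in> edges (coronoid_graph K) \<longleftrightarrow> v + mult_zeta e \<in> K \<or> v - mult_omega e \<in> K"
  using mem_hex_edges_iff[OF assms] by (auto simp: coronoid_graph_def)

lemma edge_mult_eq_1_iff:
  assumes "e \<in> units"
  shows "edge_mult K {v, v + e} = 1 \<longleftrightarrow> (v + mult_zeta e \<in> K) \<noteq> (v - mult_omega e \<in> K)"
proof -
  let ?a = "v + mult_zeta e" and ?b = "v - mult_omega e"
  have ne: "?a \<noteq> ?b"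
    using assms by (cases v) (auto simp: units_def mult_zeta_def mult_omega_def)
  have "{h \<in> K. {v, v + e} \<in> hex_edges h} = (if ?a \<in> K then {?a} else {}) \<union> (if ?b \<in> K then {?b} else {})"
    using mem_hex_edges_iff[OF assms] by auto
  then show ?thesis using ne by (simp add: edge_mult_def)
qed

lemma coronoid_edge_through:
  assumes "E \<in> edges (coronoid_graph K)" "v \<in> E"
  obtains e where "e \<in> units" "E = {v, v + e}"
proof -
  obtain h where "E \<in> hex_edges h" using assms(1) by (auto simp: coronoid_graph_def)
  then show thesis using assms(2) that by (rule hex_edge_through)
qed

lemma hexagon_iff: "(a, b) \<in> hexagons \<longleftrightarrow> 3 dvd a + b"
  by (simp add: hexagons_def)

text \<open>This is where \<open>K \<subseteq> hexagons\<close> enters. The coordinate sum of a unit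
  is never divisible by 3, so the corners around a centre have a nonzero residue. Unit steps between
  a centre and a corner are thereby ruled out.\<close>

lemma coronoid_edge_ends:
  assumes "K \<subseteq> hexagons" "e \<in> units" "{v, v + e} \<in> edges (coronoid_graph K)"
  shows "v \<notin> hexagons" "v + e \<notin> hexagons"
proof -
  have hex: "v + mult_zeta e \<in> hexagons \<or> v - mult_omega e \<in> hexagons"
    using assms coronoid_edge_iff by blast
  obtain a b c d where ve: "v = (a, b)" "e = (c, d)" by (cases v; cases e)
  have "3 dvd a + b + (2 * c - d) \<or> 3 dvd a + b + (2 * d - c)"
    using hex by (simp add: ve mult_zeta_def mult_omega_def hexagon_iff algebra_simps)
  then have "\<not> 3 dvd a + b \<and> \<not> 3 dvd a + b + (c + d)"
    using assms(2) unfolding ve units_def by - (elim insertE emptyE; simp; presburger)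
  then show "v \<notin> hexagons" "v + e \<notin> hexagons"
    by (simp_all add: ve hexagon_iff algebra_simps)
qed

text \<open>Of the six unit directions at a vertex every other one leads along an edge, and the
  residue of the coordinate sum says which three. They form one orbit of \<omega>, so any of them
  may serve as the start of the list, up to a cyclic shift.\<close>

lemma lattice_nbrs_rotation:
  assumes "v \<notin> hexagons" "v + e \<notin> hexagons" "e \<in> units"
  defines "x \<equiv> v + e" and "y \<equiv> v + mult_omega e" and "z \<equiv> v + mult_omega (mult_omega e)"
  shows "lattice_nbrs v = [x, y, z] \<or> lattice_nbrs v = [y, z, x] \<or> lattice_nbrs v = [z, x, y]"
proof -
  obtain a b where v: "v = (a, b)" by (cases v)
  have "(a + b) mod 3 \<noteq> 0" using assms(1) by (simp add: v hexagon_iff dvd_eq_mod_eq_0)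
  then have "(a + b) mod 3 = 1 \<or> (a + b) mod 3 = 2" by presburger
  then show ?thesis
  proof
    assume 1: "(a + b) mod 3 = 1"
    then have "3 dvd a + b + 2" "3 dvd a + b - 1" by presburger+
    then have "e = (1, 0) \<or> e = (0, 1) \<or> e = (-1, -1)"
      using assms(2,3) by (auto simp: units_def hexagon_iff v algebra_simps)
    then show ?thesis using 1
      by (auto simp: x_def y_def z_def v lattice_nbrs_def mult_omega_def)
  next
    assume 2: "(a + b) mod 3 = 2"
    then have "3 dvd a + b + 1" "3 dvd a + b - 2" by presburger+
    then have "e = (-1, 0) \<or> e = (0, -1) \<or> e = (1, 1)"
      using assms(2,3) by (auto simp: units_def hexagon_iff v algebra_simps)
    then show ?thesis using 2
      by (auto simp: x_def y_def z_def v lattice_nbrs_def mult_omega_def)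
  qed
qed

lemma distinct_lattice_nbrs: "distinct (lattice_nbrs v)"
  by (cases v) (auto simp: lattice_nbrs_def mult_omega_def)

lemma lattice_nbr_unit:
  assumes "u \<in> set (lattice_nbrs v)"
  obtains e where "e \<in> units" "u = v + e"
  using assms that by (auto simp: lattice_nbrs_def Let_def mult_omega_def units_def split: if_splits)

section \<open>Rotation systems and their faces\<close>

text \<open>By distinctness the search in the doubled list stops at position \<open>i\<close>; the
  second copy supplies the successor of the last entry.\<close>

lemma cyc_next_nth:
  assumes "distinct xs" "i < length xs"
  shows "cyc_next xs (xs ! i) = xs ! (Suc i mod length xs)"
proof -
  have "xs @ xs = take i xs @ xs ! i # drop (Suc i) xs @ xs"
    using id_take_nth_drop[OF assms(2)] by (metis append.assoc append_Cons)
  moreover have "x \<noteq> xs ! i" if "x \<in> set (take i xs)" for x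
    using that assms by (auto simp: in_set_conv_nth nth_eq_iff_index_eq)
  ultimately have "dropWhile (\<lambda>x. x \<noteq> xs ! i) (xs @ xs) = xs ! i # drop (Suc i) xs @ xs"
    by (simp only: dropWhile_append2 dropWhile.simps) simp
  then have "cyc_next xs (xs ! i) = hd (drop (Suc i) xs @ xs)"
    by (simp add: cyc_next_def)
  also have "\<dots> = xs ! (Suc i mod length xs)"
  proof (cases "Suc i < length xs")
    case True
    then show ?thesis by (simp add: hd_append hd_drop_conv_nth)
  next
    case False
    then have "Suc i = length xs" using assms(2) by simp
    then show ?thesis using assms(2) by (cases xs) auto
  qed
  finally show ?thesis .
qed

lemma cyc_next_in_set: "distinct xs \<Longrightarrow> y \<in> set xs \<Longrightarrow> cyc_next xs y \<in> set xs"
  by (metis cyc_next_nth in_set_conv_nth length_pos_if_in_set mod_less_divisor)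

lemma cyc_next_inj_on:
  assumes "distinct xs"
  shows "inj_on (cyc_next xs) (set xs)"
proof (rule inj_onI)
  fix x y assume "x \<in> set xs" "y \<in> set xs" and eq: "cyc_next xs x = cyc_next xs y"
  then obtain i j where ij: "i < length xs" "j < length xs" "x = xs ! i" "y = xs ! j"
    by (metis in_set_conv_nth)
  then have "Suc i mod length xs = Suc j mod length xs"
    using eq cyc_next_nth[OF assms ij(1)] cyc_next_nth[OF assms ij(2)]
      nth_eq_iff_index_eq[OF assms] ij(1) by (metis mod_less_divisor less_nat_zero_code neq0_conv)
  then have "i = j"
    using ij by (auto simp: mod_Suc split: if_splits)
  then show "x = y" using ij by simp
qed

section \<open>Faces as orbits of a permutation of the darts\<close>

definition wf_graph :: "'v graph \<Rightarrow> bool" where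
  "wf_graph G \<longleftrightarrow> (\<forall>e\<in>edges G. \<exists>u v. e = {u, v} \<and> u \<noteq> v \<and> u \<in> verts G \<and> v \<in> verts G)"

definition rotation_system :: "'v graph \<Rightarrow> 'v rotation \<Rightarrow> bool" where
  "rotation_system G R \<longleftrightarrow>
     (\<forall>v\<in>verts G. distinct (R v) \<and> set (R v) = {u. (v, u) \<in> darts G})"

lemma darts_sym: "(u, v) \<in> darts G \<longleftrightarrow> (v, u) \<in> darts G"
  by (auto simp: darts_def insert_commute)

lemma darts_verts:
  assumes "wf_graph G" "(u, v) \<in> darts G"
  shows "u \<in> verts G" "v \<in> verts G"
proof -
  have "{u, v} \<in> edges G" using assms(2) by (simp add: darts_def)
  then obtain a b where "{u, v} = {a, b}" "a \<in> verts G" "b \<in> verts G"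
    using assms(1) unfolding wf_graph_def by blast
  then show "u \<in> verts G" "v \<in> verts G" by (auto simp: doubleton_eq_iff)
qed

lemma degree_eq_card_darts:
  assumes "wf_graph G"
  shows "degree G v = card {u. (v, u) \<in> darts G}"
proof -
  have "{e \<in> edges G. v \<in> e} = (\<lambda>u. {v, u}) ` {u. (v, u) \<in> darts G}"
  proof (intro equalityI subsetI)
    fix e assume "e \<in> {e \<in> edges G. v \<in> e}"
    then obtain a b where "e = {a, b}" "a \<noteq> b" "e \<in> edges G" "v = a \<or> v = b"
      using assms by (auto simp: wf_graph_def)
    then show "e \<in> (\<lambda>u. {v, u}) ` {u. (v, u) \<in> darts G}"
      by (elim disjE) (auto simp: darts_def insert_commute intro: image_eqI[of _ _ b] image_eqI[of _ _ a])
  qed (auto simp: darts_def)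
  moreover have "inj_on (\<lambda>u. {v, u}) {u. (v, u) \<in> darts G}"
    by (auto simp: inj_on_def doubleton_eq_iff)
  ultimately show ?thesis by (simp add: degree_def card_image)
qed

lemma degree_rotation:
  assumes "wf_graph G" "rotation_system G R" "v \<in> verts G"
  shows "degree G v = length (R v)"
  using assms degree_eq_card_darts[of G v] distinct_card[of "R v"]
  by (simp add: rotation_system_def)

text \<open>The first component of the image names the vertex at which the step turns, and
  \<open>cyc_next\<close> is injective on the list of that vertex.\<close>

lemma face_step_darts:
  assumes "wf_graph G" "rotation_system G R"
  shows "face_step R \<in> darts G \<rightarrow> darts G" "inj_on (face_step R) (darts G)"
proof -
  have R: "distinct (R v)" "u \<in> set (R v)" "set (R v) = {w. (v, w) \<in> darts G}"
    if "(u, v) \<in> darts G" for u v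
    using that assms(2) darts_verts(2)[OF assms(1) that] darts_sym[of u v G]
    by (simp_all add: rotation_system_def)
  show "face_step R \<in> darts G \<rightarrow> darts G"
  proof
    fix x assume "x \<in> darts G"
    moreover obtain u v where "x = (u, v)" by (cases x)
    ultimately show "face_step R x \<in> darts G"
      using R[of u v] cyc_next_in_set[of "R v" u] by (simp add: face_step_def)
  qed
  show "inj_on (face_step R) (darts G)"
  proof (rule inj_onI)
    fix x y assume xy: "x \<in> darts G" "y \<in> darts G" "face_step R x = face_step R y"
    obtain u v w z where x: "x = (u, v)" and y: "y = (w, z)"
      by (cases x; cases y) blast
    have z: "z = v" and eq: "cyc_next (R v) u = cyc_next (R v) w"
      using xy(3) by (auto simp: face_step_def x y)
    have "u = w"
      using inj_onD[OF cyc_next_inj_on eq] xy R(1,2)[of u v] R(2)[of w v] unfolding x y z by blast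
    then show "x = y" by (simp add: x y z)
  qed
qed

text \<open>An \<open>orbit\<close> collects forward iterates only, so the way back from
  \<open>y\<close> to \<open>x\<close> comes from finiteness: an injective self-map of
  \<open>D\<close> is a permutation. Outside \<open>D\<close> the map is arbitrary, hence the
  restriction \<open>g\<close>, which is the identity there.\<close>

lemma orbit_eq_of_mem:
  assumes fin: "finite D" and inj: "inj_on f D" and f: "f \<in> D \<rightarrow> D"
    and "x \<in> D" "y \<in> orbit f x"
  shows "orbit f y = orbit f x"
proof -
  define g where "g = perm_restrict f D"
  have "bij_betw f D D"
    using endo_inj_surj[OF fin _ inj] f inj by (auto simp: bij_betw_def)
  moreover have "bij_betw g D D \<longleftrightarrow> bij_betw f D D"
    by (rule bij_betw_cong) (simp add: g_def perm_restrict_def)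
  ultimately have "g permutes D"
    by (intro bij_imp_permutes) (auto simp: g_def perm_restrict_def)
  then have cyc: "cyclic_on g (orbit g x)" using fin by (rule cyclic_on_orbit)
  have eq: "orbit g z = orbit f z" if "z \<in> D" for z
    using that f by (intro orbit_cong0[symmetric, where A = D]) (auto simp: g_def perm_restrict_def)
  have "y \<in> orbit g x" using assms eq by simp
  moreover have "y \<in> D"
    using permutes_orbit_subset[OF \<open>g permutes D\<close> \<open>x \<in> D\<close>] calculation by blast
  ultimately show ?thesis
    using orbit_cyclic_eq3[OF cyc] eq \<open>x \<in> D\<close> by metis
qed

lemma face_eq_orbit:
  assumes "wf_graph G" "rotation_system G R" "finite (darts G)"
    and "F \<in> faces G R" "x \<in> F"
  shows "F = orbit (face_step R) x"
proof -
  obtain d where "d \<in> darts G" "F = orbit (face_step R) d"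
    using assms(4) by (auto simp: faces_def)
  then show ?thesis
    using orbit_eq_of_mem[OF assms(3) face_step_darts(2,1)[OF assms(1,2)]] assms(5) by metis
qed

lemma orbit_subset_closed:
  assumes "x \<in> S" "\<And>y. y \<in> S \<Longrightarrow> f y \<in> S"
  shows "orbit f x \<subseteq> S"
proof
  fix y assume "y \<in> orbit f x"
  then show "y \<in> S" by induction (use assms in auto)
qed

text \<open>There are two closing conditions because a repeated dart means two repeated vertices.
  The number \<open>m\<close> may still be a multiple of the true period; for cardinalities,
  \<open>card_oriented_walk\<close> asks for distinct vertices.\<close>

lemma orbit_closed_walk:
  fixes b :: "nat \<Rightarrow> 'v"
  assumes b: "\<And>k. k < m \<Longrightarrow> cyc_next (R (b (Suc k))) (b k) = b (Suc (Suc k))"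
    and closed: "b m = b 0" "b (Suc m) = b 1" and "0 < m"
  shows "orbit (face_step R) (b 0, b 1) = (\<lambda>k. (b k, b (Suc k))) ` {..<m}"
proof -
  let ?f = "face_step R" and ?p = "\<lambda>k. (b k, b (Suc k))"
  have step: "?f (?p k) = ?p (Suc k)" if "k < m" for k
    using b[OF that] by (simp add: face_step_def)
  have pow: "(?f ^^ k) (?p 0) = ?p k" if "k \<le> m" for k
    using that by (induction k) (auto simp: step)
  have "orbit ?f (?p 0) = {(?f ^^ k) (?p 0) | k. k < m}"
    using pow[of m] closed \<open>0 < m\<close> by (intro orbit_altdef_bounded) auto
  also have "\<dots> = (\<lambda>k. (?f ^^ k) (?p 0)) ` {..<m}" by auto
  also have "\<dots> = ?p ` {..<m}" by (intro image_cong) (auto simp: pow)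
  finally show ?thesis by simp
qed

section \<open>Boundary vertices\<close>

text \<open>Faces lie on the right of their darts.  A walk having the face on its left (flag \<open>s\<close>) is therefore
  traced backwards by \<open>face_step\<close>.\<close>

definition orient :: "bool \<Rightarrow> 'v \<Rightarrow> 'v \<Rightarrow> 'v \<times> 'v" where
  "orient s u v = (if s then (v, u) else (u, v))"

definition turn :: "bool \<Rightarrow> 'v rotation \<Rightarrow> 'v \<Rightarrow> 'v \<Rightarrow> 'v \<Rightarrow> bool" where
  "turn s R u v w \<longleftrightarrow> (if s then cyc_next (R v) w = u else cyc_next (R v) u = w)"

lemma orbit_oriented_walk:
  fixes b :: "nat \<Rightarrow> 'v"
  assumes turn: "\<And>k. k < m \<Longrightarrow> turn s R (b k) (b (Suc k)) (b (Suc (Suc k)))"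
    and closed: "b m = b 0" "b (Suc m) = b 1" and "0 < m"
  shows "orbit (face_step R) (orient s (b 0) (b 1)) = (\<lambda>k. orient s (b k) (b (Suc k))) ` {..<m}"
proof (cases s)
  case False
  then show ?thesis
    using orbit_closed_walk[of m R b] assms by (simp add: orient_def turn_def)
next
  case True
  \<comment> \<open>Counting down from \<open>Suc m\<close> instead of \<open>m\<close> makes the
    reversed walk start with \<open>b 1\<close>, \<open>b 0\<close>, the reverse of the prescribed
    first dart.\<close>
  define b' where "b' = (\<lambda>k. b (Suc m - k))"
  have "orbit (face_step R) (b' 0, b' 1) = (\<lambda>k. (b' k, b' (Suc k))) ` {..<m}"
  proof (rule orbit_closed_walk)
    fix k assume k: "k < m"
    then have "Suc m - k = Suc (Suc (m - Suc k))" "Suc m - Suc k = Suc (m - Suc k)"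
      "Suc m - Suc (Suc k) = m - Suc k" by auto
    then show "cyc_next (R (b' (Suc k))) (b' k) = b' (Suc (Suc k))"
      using turn[of "m - Suc k"] True k by (simp add: b'_def turn_def)
  qed (use closed \<open>0 < m\<close> in \<open>simp_all add: b'_def\<close>)
  also have "\<dots> = (\<lambda>k. (b (Suc k), b k)) ` {..<m}"
  proof (intro equalityI subsetI)
    fix x assume "x \<in> (\<lambda>k. (b' k, b' (Suc k))) ` {..<m}"
    then obtain k where k: "k < m" "x = (b' k, b' (Suc k))" by auto
    show "x \<in> (\<lambda>k. (b (Suc k), b k)) ` {..<m}"
    proof (cases "k = 0")
      case True
      then have "x = (b (Suc 0), b 0)" using k closed by (simp add: b'_def)
      then show ?thesis using \<open>0 < m\<close> by blast
    next
      case False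
      then have "x = (b (Suc (m - k)), b (m - k))" "m - k < m"
        using k by (simp_all add: b'_def Suc_diff_le)
      then show ?thesis by blast
    qed
  next
    fix x assume "x \<in> (\<lambda>k. (b (Suc k), b k)) ` {..<m}"
    then obtain k where k: "k < m" "x = (b (Suc k), b k)" by auto
    show "x \<in> (\<lambda>k. (b' k, b' (Suc k))) ` {..<m}"
    proof (cases "k = 0")
      case True
      then have "x = (b' 0, b' (Suc 0))" using k closed by (simp add: b'_def)
      then show ?thesis using \<open>0 < m\<close> by blast
    next
      case False
      then have "x = (b' (m - k), b' (Suc (m - k)))" "m - k < m"
        using k by (simp_all add: b'_def Suc_diff_le)
      then show ?thesis by blast
    qed
  qed
  finally show ?thesis using True closed by (simp add: orient_def b'_def)
qed

lemma card_oriented_walk: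
  assumes "inj_on b {..<m}"
  shows "card ((\<lambda>k. orient s (b k) (b (Suc k))) ` {..<m}) = m"
proof -
  have "inj_on (\<lambda>k. orient s (b k) (b (Suc k))) {..<m}"
    using assms by (auto simp: inj_on_def orient_def)
  then show ?thesis by (simp add: card_image)
qed

section \<open>The sixth roots of unity and the surroundings of a lattice vertex\<close>

lemma unit_algebra:
  "mult_omega (mult_omega e) = - mult_zeta e"
  "mult_zeta (mult_omega e) = - e" "mult_omega (mult_zeta e) = - e"
  "mult_zeta (mult_zeta e) = mult_omega e"
  "mult_zeta (- e) = - mult_zeta e" "mult_omega (- e) = - mult_omega e"
  "mult_zeta e = e + mult_omega e"
  by (cases e; simp add: mult_zeta_def mult_omega_def)+

lemma coronoid_wf_graph: "wf_graph (coronoid_graph K)"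
  unfolding wf_graph_def
proof
  fix E assume "E \<in> edges (coronoid_graph K)"
  then obtain h x where hx: "h \<in> K" "x \<in> units" "E = {h + x, h + mult_zeta x}"
    by (auto simp: coronoid_graph_def hex_edges_def)
  have "h + x \<noteq> h + mult_zeta x"
    using hx(2) by (auto simp: units_def mult_zeta_def)
  moreover have "h + x \<in> verts (coronoid_graph K)" "h + mult_zeta x \<in> verts (coronoid_graph K)"
    using hx(1,2) mult_zeta_units[OF hx(2)] unfolding coronoid_graph_def corners_def fst_conv by blast+
  ultimately show "\<exists>u v. E = {u, v} \<and> u \<noteq> v \<and> u \<in> verts (coronoid_graph K) \<and> v \<in> verts (coronoid_graph K)"
    using hx(3) by blast
qed

lemma coronoid_dart_iff:
  assumes "K \<subseteq> hexagons"
  shows "(v, u) \<in> darts (coronoid_graph K) \<longleftrightarrow>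
    u \<in> set (lattice_nbrs v) \<and> {v, u} \<in> edges (coronoid_graph K)"
proof
  assume "(v, u) \<in> darts (coronoid_graph K)"
  then have E: "{v, u} \<in> edges (coronoid_graph K)" "u \<noteq> v" by (auto simp: darts_def)
  then obtain e where e: "e \<in> units" "{v, u} = {v, v + e}"
    using coronoid_edge_through by blast
  then have "u = v + e" using E(2) by (auto simp: doubleton_eq_iff)
  then show "u \<in> set (lattice_nbrs v) \<and> {v, u} \<in> edges (coronoid_graph K)"
    using E e lattice_nbrs_rotation[of v e] coronoid_edge_ends[OF assms e(1)] by auto
next
  assume "u \<in> set (lattice_nbrs v) \<and> {v, u} \<in> edges (coronoid_graph K)"
  moreover have "u \<noteq> v" if "u \<in> set (lattice_nbrs v)"
    using that by (rule lattice_nbr_unit) (auto simp: units_def zero_prod_def)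
  ultimately show "(v, u) \<in> darts (coronoid_graph K)" by (auto simp: darts_def)
qed

lemma degree_coronoid:
  assumes "K \<subseteq> hexagons"
  shows "degree (coronoid_graph K) v =
    length (filter (\<lambda>u. {v, u} \<in> edges (coronoid_graph K)) (lattice_nbrs v))"
proof -
  have "{u. (v, u) \<in> darts (coronoid_graph K)} =
      set (filter (\<lambda>u. {v, u} \<in> edges (coronoid_graph K)) (lattice_nbrs v))"
    using coronoid_dart_iff[OF assms] by auto
  then show ?thesis
    by (simp add: degree_eq_card_darts[OF coronoid_wf_graph] distinct_card distinct_lattice_nbrs
        del: set_filter)
qed

abbreviation left_hex :: "point \<Rightarrow> point \<Rightarrow> point" where
  "left_hex u v \<equiv> u + mult_zeta (v - u)"

abbreviation cyclic_order :: "'a list \<Rightarrow> 'a \<Rightarrow> 'a \<Rightarrow> 'a \<Rightarrow> bool" where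
  "cyclic_order xs a b c \<equiv> xs = [a, b, c] \<or> xs = [b, c, a] \<or> xs = [c, a, b]"

text \<open>Three hexagons meet at \<open>v\<close>, one between any two neighbours. Each of the two
  boundary edges has exactly one of its hexagons in \<open>K\<close>; hence the two hexagons at the
  third edge \<open>{v, r}\<close> are both in \<open>K\<close> or both outside, and the one between
  \<open>p\<close> and \<open>q\<close> has the opposite status. So \<open>{v, r}\<close> is present
  exactly if its two hexagons belong to \<open>K\<close>, and the condition in the last conclusion
  asks whether \<open>r\<close> lies to the left of the path.\<close>

lemma boundary_vertex:
  assumes K: "K \<subseteq> hexagons"
    and E: "{p, v} \<in> edges (boundary_graph K)" "{v, q} \<in> edges (boundary_graph K)" and "p \<noteq> q"
  obtains r where
    "left_hex p v \<in> K \<longleftrightarrow> left_hex v q \<in> K"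
    "{v, p} \<in> edges (coronoid_graph K)" "{v, q} \<in> edges (coronoid_graph K)"
    "degree (coronoid_graph K) v = (if {v, r} \<in> edges (coronoid_graph K) then 3 else 2)"
    "if (left_hex v q \<in> K) = ({v, r} \<in> edges (coronoid_graph K))
     then cyclic_order (lattice_nbrs v) q r p \<and> v - p = mult_zeta (q - v)
     else cyclic_order (lattice_nbrs v) q p r \<and> q - v = mult_zeta (v - p)"
proof -
  let ?G = "coronoid_graph K"
  have E': "{v, p} \<in> edges ?G" "{v, q} \<in> edges ?G" "edge_mult K {v, p} = 1" "edge_mult K {v, q} = 1"
    using E by (auto simp: boundary_graph_def insert_commute)
  have "{v, u} \<in> edges ?G \<Longrightarrow> \<exists>e\<in>units. u = v + e" for u
  proof -
    assume A: "{v, u} \<in> edges ?G"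
    obtain e where "e \<in> units" "{v, u} = {v, v + e}"
      using coronoid_edge_through[OF A] by blast
    moreover have "u \<noteq> v"
      using A coronoid_wf_graph[of K] by (auto simp: wf_graph_def doubleton_eq_iff)
    ultimately show ?thesis by (auto simp: doubleton_eq_iff)
  qed
  then obtain e e' where e: "e \<in> units" "q = v + e" and e': "e' \<in> units" "p = v + e'"
    using E'(1,2) by metis
  have nbrs: "cyclic_order (lattice_nbrs v) q (v + mult_omega e) (v - mult_zeta e)"
    using lattice_nbrs_rotation[of v e] coronoid_edge_ends[OF K e(1)] e E'(2)
    by (simp add: unit_algebra(1))
  have "p \<in> set (lattice_nbrs v)"
    using lattice_nbrs_rotation[of v e'] coronoid_edge_ends[OF K e'(1)] e' E'(1) by auto
  then have "p = v + mult_omega e \<or> p = v - mult_zeta e"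
    using nbrs \<open>p \<noteq> q\<close> by auto
  have units: "mult_omega e \<in> units" "- mult_zeta e \<in> units"
    using e(1) mult_omega_units unit_algebra(1) by metis+
  note iffs = edge_mult_eq_1_iff[OF e(1), of K v] edge_mult_eq_1_iff[OF units(1), of K v]
    edge_mult_eq_1_iff[OF units(2), of K v] coronoid_edge_iff[OF e(1), of v K]
    coronoid_edge_iff[OF units(1), of v K] coronoid_edge_iff[OF units(2), of v K]
  have deg: "degree ?G v = length (filter (\<lambda>u. {v, u} \<in> edges ?G) [q, v + mult_omega e, v - mult_zeta e])"
    using nbrs unfolding degree_coronoid[OF K] by auto
  show thesis
    using \<open>p = v + mult_omega e \<or> p = v - mult_zeta e\<close>
  proof
    assume p: "p = v + mult_omega e"
    \<comment> \<open>Left turn: a single hexagon lies to the left of both edges, and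
      \<open>r\<close> is on the right.\<close>
    have left: "left_hex p v = v + mult_zeta e"
      by (simp add: p unit_algebra(2,5)) (simp add: unit_algebra(7))
    show thesis
    proof (rule that[of "v - mult_zeta e"])
      show "left_hex p v \<in> K \<longleftrightarrow> left_hex v q \<in> K" using left by (simp add: e(2))
    qed (use iffs E' deg nbrs in \<open>auto simp: p e(2) unit_algebra(1-6)\<close>)
  next
    assume p: "p = v - mult_zeta e"
    \<comment> \<open>Right turn: the two left hexagons are different, but they are the two at
      \<open>{v, r}\<close>, whose status agrees.\<close>
    have left: "left_hex p v = v - e"
      by (simp add: p unit_algebra(4)) (simp add: unit_algebra(7))
    show thesis
    proof (rule that[of "v + mult_omega e"])
      show "left_hex p v \<in> K \<longleftrightarrow> left_hex v q \<in> K"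
        unfolding left using iffs E' by (auto simp: p e(2) unit_algebra(1-6))
    qed (use iffs E' deg nbrs in \<open>auto simp: p e(2) unit_algebra(1-6)\<close>)
  qed
qed

section \<open>Codes and closed walks\<close>

text \<open>The index of the 2 that opens block \<open>i\<close>; at \<open>i = length ls\<close> it
  is the length of the whole code.\<close>

definition block_pos :: "nat list \<Rightarrow> nat \<Rightarrow> nat" where
  "block_pos ls i = sum_list (map Suc (take i ls))"

abbreviation block_code :: "nat list \<Rightarrow> nat list" where
  "block_code ls \<equiv> concat (map (\<lambda>l. 2 # replicate l 3) ls)"

lemma block_pos_Suc: "i < length ls \<Longrightarrow> block_pos ls (Suc i) = block_pos ls i + ls ! i + 1"
  by (simp add: block_pos_def take_Suc_conv_app_nth)

lemma block_pos_Cons_Suc: "block_pos (l # ls) (Suc i) = Suc l + block_pos ls i"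
  by (simp add: block_pos_def)

lemma length_block_code: "length (block_code ls) = block_pos ls (length ls)"
  by (induction ls) (simp_all add: block_pos_def)

lemma block_pos_mono:
  assumes "i \<le> j" "j \<le> length ls"
  shows "block_pos ls i \<le> block_pos ls j"
proof -
  have "take j ls = take i ls @ take (j - i) (drop i ls)"
    using assms(1) take_add[of i "j - i" ls] by simp
  then show ?thesis by (simp add: block_pos_def)
qed

lemma block_pos_less:
  assumes "i < length ls" "k \<le> ls ! i"
  shows "block_pos ls i + k < block_pos ls (length ls)"
  using block_pos_mono[of "Suc i" "length ls" ls] block_pos_Suc[of i ls] assms by simp

lemma nth_block_code:
  assumes "i < length ls" "k \<le> ls ! i"
  shows "block_code ls ! (block_pos ls i + k) = (if k = 0 then 2 else 3)"
  using assms
proof (induction ls arbitrary: i)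
  case (Cons l ls)
  show ?case
  proof (cases i)
    case 0
    then show ?thesis using Cons.prems by (cases k) (auto simp: block_pos_def nth_append)
  next
    case (Suc i')
    then show ?thesis using Cons by (simp add: block_pos_Cons_Suc nth_append)
  qed
qed simp

text \<open>Applied with the degree as \<open>g\<close>, this locates the degree-2 vertices of the
  perimeter. The induction splits off one block, whose only 2 is its head.\<close>

lemma filter_block_code:
  assumes "map g xs = block_code ls"
  shows "filter (\<lambda>x. g x = 2) xs = map (\<lambda>i. xs ! block_pos ls i) [0..<length ls]"
  using assms
proof (induction ls arbitrary: xs)
  case (Cons l ls)
  have len: "Suc l \<le> length xs"
    using arg_cong[OF Cons.prems, of length] by simp
  define ys zs where "ys = take (Suc l) xs" and "zs = drop (Suc l) xs"
  have ys: "map g ys = 2 # replicate l 3" and zs: "map g zs = block_code ls"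
    using Cons.prems by (simp_all add: ys_def zs_def flip: take_map drop_map)
  obtain y ys' where y: "ys = y # ys'" "g y = 2" "map g ys' = replicate l 3"
    using ys by auto
  have "g x = 3" if "x \<in> set ys'" for x
    using y(3) that by (metis (mono_tags) image_eqI in_set_replicate list.set_map)
  then have "filter (\<lambda>x. g x = 2) ys = [y]" using y by (auto simp: filter_empty_conv)
  moreover have xs: "xs = ys @ zs" by (simp add: ys_def zs_def)
  moreover have "length ys = Suc l" using len by (simp add: ys_def)
  moreover have "xs ! 0 = y" by (simp add: xs y)
  ultimately show ?case
    using Cons.IH[OF zs] 
    by (simp add: upt_conv_Cons map_Suc_upt[symmetric] block_pos_Cons_Suc nth_append comp_def
        del: upt_Suc) (simp add: block_pos_def)
qed simp

section \<open>Walks that turn by sixty degrees at every step\<close>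

lemma zeta_power_eq_zeta:
  assumes "(mult_zeta ^^ (n - 1)) z = mult_zeta z" "3 \<le> n" "n \<le> 6"
  shows "z = 0"
proof -
  \<comment> \<open>For nonzero \<open>z\<close> the equation would give \<zeta>^(n - 2) = 1, but
    \<open>n - 2\<close> lies between 1 and 4 while \<zeta> has order 6.\<close>
  have "n - 1 = 2 \<or> n - 1 = 3 \<or> n - 1 = 4 \<or> n - 1 = 5" using assms(2,3) by linarith
  then show ?thesis
    using assms(1)
    by (cases z) (elim disjE; simp add: eval_nat_numeral mult_zeta_def zero_prod_def)
qed

lemma zeta_power_sum:
  "(\<Sum>k<6. (mult_zeta ^^ k) z) = 0"
  by (cases z) (simp add: eval_nat_numeral mult_zeta_def zero_prod_def)

text \<open>The equal turns at the indices 1 to \<open>n - 1\<close> relate the first and the last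
  edge by \<zeta>^(n - 1), whereas the opposite turn at \<open>C n = C 0\<close> relates them by a
  single factor \<zeta>. The two alternatives are mirror images.\<close>

lemma closed_walk_turns:
  fixes C :: "nat \<Rightarrow> point"
  assumes "3 \<le> n" "inj_on C {..<n}" "C n = C 0" "C (Suc n) = C 1"
    and turn: "(\<forall>k. Suc k < n \<longrightarrow>
        C (Suc (Suc k)) - C (Suc k) = mult_zeta (C (Suc k) - C k)) \<and>
      C n - C (n - 1) = mult_zeta (C (Suc n) - C n) \<or>
     (\<forall>k. Suc k < n \<longrightarrow>
        C (Suc k) - C k = mult_zeta (C (Suc (Suc k)) - C (Suc k))) \<and>
      C (Suc n) - C n = mult_zeta (C n - C (n - 1))"
  shows False
proof -
  define e where "e k = C (Suc k) - C k" for k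
  have ne: "e 0 \<noteq> 0" using inj_onD[OF assms(2), of 1 0] assms(1) by (auto simp: e_def)
  have last: "e n = e 0" "C n - C (n - 1) = e (n - 1)"
    using assms(1,3,4) by (simp_all add: e_def)
  have sum: "(\<Sum>k<6. e k) = C 6 - C 0"
    unfolding e_def by (rule sum_lessThan_telescope)
  \<comment> \<open>For \<open>n > 6\<close> the vertices \<open>C 6\<close> and \<open>C 0\<close>
    are distinct, so a zero sum is contradictory; for \<open>n \<le> 6\<close> the contradiction is
    a vanishing first edge.\<close>
  have "(n \<le> 6 \<or> (\<Sum>k<6. e k) = 0) \<and> (6 < n \<or> e 0 = 0)"
    using turn
  proof (elim disjE conjE)
    assume step: "\<forall>k. Suc k < n \<longrightarrow>
        C (Suc (Suc k)) - C (Suc k) = mult_zeta (C (Suc k) - C k)"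
      and "C n - C (n - 1) = mult_zeta (C (Suc n) - C n)"
    then have l: "e (n - 1) = mult_zeta (e 0)" using last by (simp add: e_def)
    have pow: "e k = (mult_zeta ^^ k) (e 0)" if "k < n" for k
      using that
    proof (induction k)
      case (Suc k)
      have "e (Suc k) = mult_zeta (e k)" unfolding e_def using step Suc.prems by blast
      then show ?case using Suc by simp
    qed simp
    have "(\<Sum>k<6. e k) = 0" if "6 < n"
    proof -
      have "(\<Sum>k<6. e k) = (\<Sum>k<6. (mult_zeta ^^ k) (e 0))"
        by (intro sum.cong refl pow) (use that in auto)
      then show ?thesis by (simp only: zeta_power_sum)
    qed
    moreover have "e 0 = 0" if "n \<le> 6"
      using zeta_power_eq_zeta[of n "e 0"] l pow[of "n - 1"] assms(1) that by simp
    ultimately show ?thesis by linarith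
  next
    assume step: "\<forall>k. Suc k < n \<longrightarrow>
        C (Suc k) - C k = mult_zeta (C (Suc (Suc k)) - C (Suc k))"
      and "C (Suc n) - C n = mult_zeta (C n - C (n - 1))"
    then have l: "e 0 = mult_zeta (e (n - 1))" using last by (simp add: e_def)
    \<comment> \<open>Each edge is now \<zeta> times the next one, so an edge is expressed through a
      later one; all of the first six go back to \<open>e 5\<close>.\<close>
    have pow: "e k = (mult_zeta ^^ j) (e (k + j))" if "k + j < n" for k j
      using that
    proof (induction j)
      case (Suc j)
      have "e (k + j) = mult_zeta (e (Suc (k + j)))" unfolding e_def using step Suc.prems by simp
      then show ?case using Suc by (simp add: funpow_swap1)
    qed simp
    have "(\<Sum>k<6. e k) = 0" if "6 < n"
    proof -
      have "(\<Sum>k<6. e k) = (\<Sum>k<6. (mult_zeta ^^ (5 - k)) (e 5))"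
      proof (intro sum.cong refl)
        fix k :: nat assume "k \<in> {..<6}"
        then show "e k = (mult_zeta ^^ (5 - k)) (e 5)" using pow[of k "5 - k"] that by simp
      qed
      also have "\<dots> = (\<Sum>k<6. (mult_zeta ^^ k) (e 5))"
        using sum.nat_diff_reindex[of "\<lambda>k. (mult_zeta ^^ k) (e 5)" 6]
        by simp
      finally show ?thesis by (simp only: zeta_power_sum)
    qed
    moreover have "e 0 = 0" if "n \<le> 6"
    proof -
      have "e (n - 1) = 0"
        using zeta_power_eq_zeta[of n "e (n - 1)"] l pow[of 0 "n - 1"] assms(1) that by simp
      then show ?thesis using l by (simp add: mult_zeta_def zero_prod_def)
    qed
    ultimately show ?thesis by linarith
  qed
  then show False using ne sum inj_onD[OF assms(2), of 6 0] by auto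
qed

section \<open>Coded perimeters\<close>

lemma finite_coronoid_edges: "finite K \<Longrightarrow> finite (edges (coronoid_graph K))"
  by (simp add: coronoid_graph_def hex_edges_def units_def)

lemma finite_darts:
  assumes "wf_graph G" "finite (edges G)"
  shows "finite (darts G)"
proof -
  have "finite e" if "e \<in> edges G" for e
    using assms(1) that by (fastforce simp: wf_graph_def)
  moreover have "darts G \<subseteq> \<Union>(edges G) \<times> \<Union>(edges G)" by (auto simp: darts_def)
  ultimately show ?thesis
    using assms(2) by (meson finite_SigmaI finite_Union finite_subset)
qed

lemma cyc_next_3:
  assumes "cyclic_order xs a b c" "a \<noteq> b" "b \<noteq> c" "a \<noteq> c"
  shows "cyc_next xs a = b" "cyc_next xs b = c" "cyc_next xs c = a"
  using assms by (auto simp: cyc_next_def)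

lemma mem_face_edges: "{u, v} \<in> face_edges F \<longleftrightarrow> (u, v) \<in> F \<or> (v, u) \<in> F"
  by (auto simp: face_edges_def image_iff doubleton_eq_iff)

lemma face_step_orient:
  "turn s R u v w \<Longrightarrow> face_step R (if s then orient s v w else orient s u v) =
     (if s then orient s u v else orient s v w)"
  by (simp add: turn_def orient_def face_step_def)

text \<open>The code makes the traversal start at the degree-2 vertex before the first block. Its
  direction remains free, so either value of \<open>hole_on_left\<close> is possible.\<close>

locale coded_perimeter =
  fixes K :: "point set" and c :: "point list" and ls :: "nat list"
  assumes K: "K \<subseteq> hexagons" "finite K"
    and perimeter: "perimeter K c"
    and code: "degree_sequence (coronoid_graph K) c = block_code ls"
begin

abbreviation G :: "point graph" where "G \<equiv> coronoid_graph K"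
abbreviation n :: nat where "n \<equiv> length c"
abbreviation d :: nat where "d \<equiv> length ls"
abbreviation A :: "point altan_vertex graph" where "A \<equiv> altan G c"
abbreviation R :: "point altan_vertex rotation" where "R \<equiv> altan_rotation K c"
abbreviation hl :: bool where "hl \<equiv> hole_on_left K c"
abbreviation pos :: "nat \<Rightarrow> nat" where "pos \<equiv> block_pos ls"

text \<open>A periodic sequence, so that a block or a neighbour may run past the end of the list
  without a case distinction.\<close>

definition C :: "nat \<Rightarrow> point" where "C k = c ! (k mod n)"
definition vs :: "point list" where "vs = deg2_vertices G c"

lemma cycle: "3 \<le> n" "distinct c" and C_edge: "{C k, C (Suc k)} \<in> edges (boundary_graph K)"
proof -
  show "3 \<le> n" "distinct c" using perimeter by (auto simp: perimeter_def is_cycle_def)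
  then have "0 < n" by linarith
  then have "{c ! (k mod n), c ! (Suc (k mod n) mod n)} \<in> edges (boundary_graph K)"
    using perimeter by (simp add: perimeter_def is_cycle_def)
  then show "{C k, C (Suc k)} \<in> edges (boundary_graph K)" by (simp add: C_def mod_Suc_eq)
qed

lemma mod_n: "k mod n < n"
  using cycle(1) by (intro mod_less_divisor) linarith

lemma C_eq_iff: "C j = C k \<longleftrightarrow> j mod n = k mod n"
  unfolding C_def using nth_eq_iff_index_eq[OF cycle(2) mod_n mod_n] .

lemma C_mem: "C k \<in> set c"
  unfolding C_def using mod_n by simp

lemma C_shift_inj: "inj_on (\<lambda>k. C (m + k)) {..<n}"
proof (rule linorder_inj_onI)
  fix j k assume jk: "j < k" "j \<in> {..<n}" "k \<in> {..<n}"
  show "C (m + j) \<noteq> C (m + k)"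
  proof
    assume "C (m + j) = C (m + k)"
    then have "n dvd (m + k) - (m + j)"
      using jk(1) by (subst mod_eq_dvd_iff_nat[symmetric]) (simp_all add: C_eq_iff)
    then show False using jk by (auto dest: dvd_imp_le)
  qed
qed (simp add: linorder_linear)

lemma C_skip: "C k \<noteq> C (Suc (Suc k))"
proof -
  have "0 < n" "2 < n" using cycle(1) by linarith+
  then show ?thesis using inj_onD[OF C_shift_inj[of k], of 0 2] by auto
qed

lemma C_period: "C (n + k) = C k"
  by (simp add: C_def)

text \<open>\<open>hole_on_left\<close> speaks of all vertices, so its failure yields only one
  hexagon of \<open>K\<close> on the left. The first conclusion of \<open>boundary_vertex\<close>
  carries the status from edge to edge and turns this into a statement about every edge.\<close>

lemma left_hex_iff: "left_hex (C k) (C (Suc k)) \<in> K \<longleftrightarrow> \<not> hl"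
proof -
  have const: "left_hex (C k) (C (Suc k)) \<in> K \<longleftrightarrow> left_hex (C 0) (C 1) \<in> K" for k
  proof (induction k)
    case (Suc k)
    then show ?case
      by (rule_tac boundary_vertex[OF K(1) C_edge[of k] C_edge[of "Suc k"] C_skip]) blast
  qed simp
  have next_C: "cyc_next c (C k) = C (Suc k)" for k
    unfolding C_def using cyc_next_nth[OF cycle(2) mod_n[of k]] by (simp add: mod_Suc_eq)
  have "hl \<longleftrightarrow> (\<forall>k. left_hex (C k) (C (Suc k)) \<notin> K)"
  proof
    assume hl
    then show "\<forall>k. left_hex (C k) (C (Suc k)) \<notin> K"
      using C_mem by (fastforce simp: hole_on_left_def next_C)
  next
    assume a: "\<forall>k. left_hex (C k) (C (Suc k)) \<notin> K"
    show hl
      unfolding hole_on_left_def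
    proof
      fix v assume "v \<in> set c"
      then obtain k where "k < n" "v = c ! k" by (metis in_set_conv_nth)
      then have "v = C k" by (simp add: C_def)
      then show "left_hex v (cyc_next c v) \<notin> K" using a by (simp add: next_C)
    qed
  qed
  then show ?thesis using const by blast
qed

text \<open>Here \<open>r\<close> is the third lattice neighbour of the vertex; it lies on the side of the hole
  exactly if the edge to it is missing.\<close>

definition local_picture :: "nat \<Rightarrow> point \<Rightarrow> bool" where
  "local_picture k r \<longleftrightarrow> (let p = C k; v = C (Suc k); q = C (Suc (Suc k)) in
     {v, p} \<in> edges G \<and> {v, q} \<in> edges G \<and>
     degree G v = (if {v, r} \<in> edges G then 3 else 2) \<and>
     (if hl = ({v, r} \<in> edges G)
      then cyclic_order (lattice_nbrs v) q p r \<and> q - v = mult_zeta (v - p)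
      else cyclic_order (lattice_nbrs v) q r p \<and> v - p = mult_zeta (q - v)))"

lemma ex_local_picture: "\<exists>r. local_picture k r"
proof (rule boundary_vertex[OF K(1) C_edge[of k] C_edge[of "Suc k"] C_skip])
  fix r
  let ?p = "C k" and ?v = "C (Suc k)" and ?q = "C (Suc (Suc k))"
  assume r: "{?v, ?p} \<in> edges G" "{?v, ?q} \<in> edges G"
    "degree G ?v = (if {?v, r} \<in> edges G then 3 else 2)"
    "if (left_hex ?v ?q \<in> K) = ({?v, r} \<in> edges G)
     then cyclic_order (lattice_nbrs ?v) ?q r ?p \<and> ?v - ?p = mult_zeta (?q - ?v)
     else cyclic_order (lattice_nbrs ?v) ?q ?p r \<and> ?q - ?v = mult_zeta (?v - ?p)"
  then have "local_picture k r"
    by (simp add: local_picture_def Let_def left_hex_iff split: if_splits)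
  then show ?thesis ..
qed

text \<open>The perimeter bends towards the hole at degree 3 and away from it at degree 2; a bend to
  the left is a multiplication by \<zeta>.\<close>

lemma C_step:
  "hl = (degree G (C (Suc k)) = 3) \<Longrightarrow> C (Suc (Suc k)) - C (Suc k) = mult_zeta (C (Suc k) - C k)"
  "hl \<noteq> (degree G (C (Suc k)) = 3) \<Longrightarrow> C (Suc k) - C k = mult_zeta (C (Suc (Suc k)) - C (Suc k))"
proof -
  obtain r where r: "local_picture k r" using ex_local_picture by blast
  then have iff: "{C (Suc k), r} \<in> edges G \<longleftrightarrow> degree G (C (Suc k)) = 3"
    by (simp add: local_picture_def Let_def)
  show "hl = (degree G (C (Suc k)) = 3) \<Longrightarrow> C (Suc (Suc k)) - C (Suc k) = mult_zeta (C (Suc k) - C k)"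
    "hl \<noteq> (degree G (C (Suc k)) = 3) \<Longrightarrow> C (Suc k) - C k = mult_zeta (C (Suc (Suc k)) - C (Suc k))"
    using r unfolding local_picture_def Let_def iff if_bool_eq_conj by blast+
qed

lemma length_c: "n = pos d"
  using arg_cong[OF code, of length] by (simp add: degree_sequence_def length_block_code[symmetric])

lemma vs_eq: "vs = map (\<lambda>i. C (pos i)) [0..<d]"
proof -
  have "vs = map (\<lambda>i. c ! pos i) [0..<d]"
    unfolding vs_def deg2_vertices_def
    by (rule filter_block_code) (use code in \<open>simp add: degree_sequence_def\<close>)
  also have "\<dots> = map (\<lambda>i. C (pos i)) [0..<d]"
    using block_pos_less[of _ ls 0] length_c by (auto simp: C_def)
  finally show ?thesis .
qed

lemma length_vs [simp]: "length vs = d" "length (deg2_vertices G c) = d"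
  using vs_eq vs_def by simp_all

lemma vs_nth: "i < d \<Longrightarrow> vs ! i = C (pos i)"
  by (simp add: vs_eq)

lemma distinct_vs: "distinct vs"
  using cycle(2) by (simp add: vs_def deg2_vertices_def)

lemma degree_block:
  assumes "i < d" "k \<le> ls ! i"
  shows "degree G (C (pos i + k)) = (if k = 0 then 2 else 3)"
proof -
  have "pos i + k < n" using block_pos_less[OF assms] length_c by simp
  then have "degree G (C (pos i + k)) = degree_sequence G c ! (pos i + k)"
    by (simp add: degree_sequence_def C_def)
  then show ?thesis using nth_block_code[OF assms] by (simp add: code)
qed

lemma vs_next:
  assumes "i < d"
  shows "vs ! (Suc i mod d) = C (pos i + Suc (ls ! i))"
proof (cases "Suc i < d")
  case True
  then show ?thesis using block_pos_Suc[OF assms] by (simp add: vs_nth)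
next
  case False
  then have "Suc i = d" using assms by simp
  \<comment> \<open>The last block ends at index \<open>n\<close>, where \<open>C\<close> is back at
    the first degree-2 vertex.\<close>
  moreover have "pos i + Suc (ls ! i) = n"
    using block_pos_Suc[OF assms] \<open>Suc i = d\<close> length_c by simp
  moreover have "vs ! 0 = C 0"
    using vs_nth[of 0] order.strict_trans1[OF le0 assms] by (simp add: block_pos_def)
  ultimately show ?thesis using C_period[of 0] by simp
qed

text \<open>A single degree-2 vertex would be \<open>C 0 = C n\<close>, with degree 3 at all indices
  in between. This is the walk refuted by \<open>closed_walk_turns\<close>, the exceptional turn
  being at index \<open>n\<close>; the value of \<open>hl\<close> selects the alternative.\<close>

lemma d_ge_2: "2 \<le> d"
proof (rule ccontr)
  assume "\<not> 2 \<le> d"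
  moreover have "d \<noteq> 0" using length_c cycle(1) by (auto simp: block_pos_def)
  ultimately have "d = 1" by linarith
  then have n: "n = Suc (ls ! 0)"
    using length_c block_pos_Suc[of 0 ls] by (simp add: block_pos_def)
  have pos0: "pos 0 = 0" by (simp add: block_pos_def)
  have deg2: "degree G (C n) = 2"
    using degree_block[of 0 0] \<open>d = 1\<close> pos0 C_period[of 0] by simp
  have deg3: "degree G (C (Suc k)) = 3" if "Suc k < n" for k
  proof -
    have "0 < d" "Suc k \<le> ls ! 0" using that n \<open>d = 1\<close> by linarith+
    from degree_block[OF this] show ?thesis unfolding pos0 by simp
  qed
  have n1: "Suc (n - 1) = n" using cycle(1) by simp
  have step: "hl \<Longrightarrow> Suc k < n \<Longrightarrow> C (Suc (Suc k)) - C (Suc k) = mult_zeta (C (Suc k) - C k)"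
    "\<not> hl \<Longrightarrow> Suc k < n \<Longrightarrow> C (Suc k) - C k = mult_zeta (C (Suc (Suc k)) - C (Suc k))" for k
    using C_step[of k] deg3[of k] by blast+
  have last: "hl \<Longrightarrow> C n - C (n - 1) = mult_zeta (C (Suc n) - C n)"
    "\<not> hl \<Longrightarrow> C (Suc n) - C n = mult_zeta (C n - C (n - 1))"
    using C_step[of "n - 1"] deg2 unfolding n1 by simp_all
  have "inj_on C {..<n}" "C n = C 0" "C (Suc n) = C 1"
    using C_shift_inj[of 0] C_period[of 0] C_period[of 1] by simp_all
  then show False
    using closed_walk_turns[of n C] cycle(1) step last by blast
qed

section \<open>The altan\<close>

lemma altan_eq:
  "verts A = Old ` verts G \<union> W ` {..<d} \<union> X ` {..<d}"
  "edges A = (\<lambda>e. Old ` e) ` edges G \<union> (\<lambda>i. {Old (vs ! i), W i}) ` {..<d} \<union>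
     (\<lambda>i. {W i, X i}) ` {..<d} \<union> (\<lambda>i. {X i, W (Suc i mod d)}) ` {..<d}"
  by (simp_all add: altan_def Let_def spoke_def vs_def)

lemma Suc_mod_d: "Suc i mod d < d"
  using d_ge_2 by (intro mod_less_divisor) linarith

lemma pred_mod_d: "(i + d - 1) mod d < d"
  using d_ge_2 by (intro mod_less_divisor) linarith

lemma Suc_mod_eq_iff:
  assumes "i < d" "k < d"
  shows "Suc k mod d = i \<longleftrightarrow> k = (i + d - 1) mod d"
proof (cases i)
  case 0
  then show ?thesis using assms d_ge_2 by (auto simp: mod_Suc)
next
  case (Suc j)
  then show ?thesis using assms by (auto simp: mod_Suc)
qed

lemma Suc_mod_neq: "i < d \<Longrightarrow> Suc i mod d \<noteq> i"
  using d_ge_2 by (auto simp: mod_Suc)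

lemma pred_mod_neq:
  assumes "i < d"
  shows "(i + d - 1) mod d \<noteq> i"
  using Suc_mod_eq_iff[OF assms assms] Suc_mod_neq[OF assms] by simp

lemma vs_mem_G: "i < d \<Longrightarrow> vs ! i \<in> verts G"
  using perimeter C_mem[of "pos i"]
  by (auto simp: perimeter_def is_cycle_def boundary_graph_def vs_nth)

lemma altan_edge_cases:
  assumes "e \<in> edges A"
  obtains (old) u v where "e = {Old u, Old v}" "(u, v) \<in> darts G"
    | (spoke) i where "i < d" "e = {Old (vs ! i), W i}"
    | (wx) i where "i < d" "e = {W i, X i}"
    | (xw) i where "i < d" "e = {X i, W (Suc i mod d)}"
proof -
  consider E where "E \<in> edges G" "e = Old ` E" | i where "i < d" "e = {Old (vs ! i), W i}"
    | i where "i < d" "e = {W i, X i}" | i where "i < d" "e = {X i, W (Suc i mod d)}"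
    using assms unfolding altan_eq by blast
  then show thesis
  proof cases
    case 1
    then obtain u v where "E = {u, v}" "u \<noteq> v"
      using coronoid_wf_graph[of K] unfolding wf_graph_def by blast
    then show thesis using old 1 by (auto simp: darts_def)
  qed (use spoke wx xw in blast)+
qed

lemma wf_altan: "wf_graph A"
  unfolding wf_graph_def
proof
  fix e assume "e \<in> edges A"
  then show "\<exists>u v. e = {u, v} \<and> u \<noteq> v \<and> u \<in> verts A \<and> v \<in> verts A"
  proof (cases rule: altan_edge_cases)
    case (old u v)
    then have "Old u \<noteq> Old v" "Old u \<in> verts A" "Old v \<in> verts A"
      using darts_verts[OF coronoid_wf_graph] by (auto simp: darts_def altan_eq)
    then show ?thesis using old by blast
  next
    case (spoke i)
    then have "Old (vs ! i) \<noteq> W i" "Old (vs ! i) \<in> verts A" "W i \<in> verts A"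
      using vs_mem_G by (auto simp: altan_eq)
    then show ?thesis using spoke by blast
  next
    case (wx i)
    then have "W i \<noteq> X i" "W i \<in> verts A" "X i \<in> verts A" by (auto simp: altan_eq)
    then show ?thesis using wx by blast
  next
    case (xw i)
    then have "X i \<noteq> W (Suc i mod d)" "W (Suc i mod d) \<in> verts A" "X i \<in> verts A"
      using Suc_mod_d by (auto simp: altan_eq)
    then show ?thesis using xw by blast
  qed
qed

lemma finite_darts_altan: "finite (darts A)"
  using finite_coronoid_edges[OF K(2)] by (intro finite_darts wf_altan) (simp add: altan_eq)

lemma darts_Old:
  "(Old v, y) \<in> darts A \<longleftrightarrow>
    (\<exists>u. y = Old u \<and> (v, u) \<in> darts G) \<or> (\<exists>i<d. vs ! i = v \<and> y = W i)"
proof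
  assume "(Old v, y) \<in> darts A"
  then have "{Old v, y} \<in> edges A" by (simp add: darts_def)
  then show "(\<exists>u. y = Old u \<and> (v, u) \<in> darts G) \<or> (\<exists>i<d. vs ! i = v \<and> y = W i)"
    by (cases rule: altan_edge_cases) (auto simp: doubleton_eq_iff darts_sym)
next
  assume "(\<exists>u. y = Old u \<and> (v, u) \<in> darts G) \<or> (\<exists>i<d. vs ! i = v \<and> y = W i)"
  then show "(Old v, y) \<in> darts A"
  proof (elim disjE exE conjE)
    fix u assume u: "y = Old u" "(v, u) \<in> darts G"
    then have "Old ` {v, u} \<in> (\<lambda>e. Old ` e) ` edges G" unfolding darts_def by blast
    then have "{Old v, Old u} \<in> edges A" by (simp add: altan_eq)
    then show ?thesis using u by (simp add: darts_def)
  qed (auto simp: darts_def altan_eq)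
qed

lemma darts_W:
  "(W i, y) \<in> darts A \<longleftrightarrow> i < d \<and> (y = Old (vs ! i) \<or> y = X i \<or> y = X ((i + d - 1) mod d))"
proof
  assume "(W i, y) \<in> darts A"
  then have "{W i, y} \<in> edges A" by (simp add: darts_def)
  then show "i < d \<and> (y = Old (vs ! i) \<or> y = X i \<or> y = X ((i + d - 1) mod d))"
  proof (cases rule: altan_edge_cases)
    case (xw k)
    then have "Suc k mod d = i" "y = X k" by (auto simp: doubleton_eq_iff)
    moreover have "i < d" using Suc_mod_d calculation by blast
    ultimately show ?thesis using Suc_mod_eq_iff[of i k] xw(1) by blast
  qed (auto simp: doubleton_eq_iff)
next
  assume *: "i < d \<and> (y = Old (vs ! i) \<or> y = X i \<or> y = X ((i + d - 1) mod d))"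
  then have "Suc ((i + d - 1) mod d) mod d = i" using Suc_mod_eq_iff pred_mod_d by blast
  then have "{X ((i + d - 1) mod d), W i} \<in> edges A"
    unfolding altan_eq using pred_mod_d[of i] by (metis (mono_tags, lifting) UnI2 imageI lessThan_iff)
  then show "(W i, y) \<in> darts A"
    using * unfolding darts_def altan_eq by (auto simp: insert_commute)
qed

lemma darts_X:
  "(X i, y) \<in> darts A \<longleftrightarrow> i < d \<and> (y = W i \<or> y = W (Suc i mod d))"
proof
  assume "(X i, y) \<in> darts A"
  then have "{X i, y} \<in> edges A" by (simp add: darts_def)
  then show "i < d \<and> (y = W i \<or> y = W (Suc i mod d))"
    by (cases rule: altan_edge_cases) (auto simp: doubleton_eq_iff)
next
  assume "i < d \<and> (y = W i \<or> y = W (Suc i mod d))"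
  then show "(X i, y) \<in> darts A"
    unfolding darts_def altan_eq by (auto simp: insert_commute)
qed

section \<open>The rotation system of the altan\<close>

definition spokes_at :: "point \<Rightarrow> point altan_vertex list" where
  "spokes_at v = map W (filter (\<lambda>i. vs ! i = v) [0..<d])"

lemma R_Old: "R (Old v) =
    concat (map (\<lambda>u. if {v, u} \<in> edges G then [Old u] else spokes_at v) (lattice_nbrs v))"
  by (simp add: Let_def spokes_at_def vs_def cong: map_cong if_cong)

lemma R_W: "R (W i) = (if hl then [X i, X ((i + d - 1) mod d), Old (vs ! i)]
      else [X i, Old (vs ! i), X ((i + d - 1) mod d)])"
  by (simp add: Let_def vs_def)

lemma R_X: "R (X i) = [W i, W (Suc i mod d)]"
  by (simp add: Let_def)

declare altan_rotation.simps [simp del]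

lemma spokes_at_vs: "i < d \<Longrightarrow> spokes_at (vs ! i) = [W i]"
proof -
  assume i: "i < d"
  have "filter (\<lambda>k. vs ! k = vs ! i) [0..<d] = filter (\<lambda>k. k = i) [0..<d]"
    using i distinct_vs nth_eq_iff_index_eq[of vs] by (intro filter_cong) auto
  also have "filter (\<lambda>k. k = i) [0..<m] = [i]" if "i < m" for m
    using that by (induction m) (auto simp: filter_empty_conv less_Suc_eq)
  note this[OF i]
  finally show ?thesis by (simp add: spokes_at_def)
qed

lemma spokes_at_empty: "v \<notin> set vs \<Longrightarrow> spokes_at v = []"
  by (auto simp: spokes_at_def filter_empty_conv in_set_conv_nth)

lemma set_spokes_at: "set (spokes_at v) = {W i | i. i < d \<and> vs ! i = v}"
  by (auto simp: spokes_at_def)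

text \<open>\<open>spokes_at v\<close> is inserted once for every absent lattice edge at
  \<open>v\<close>. At an end of a spoke, degree 2 means exactly one absent edge, so the spoke
  occurs once; at any other vertex the inserted list is empty. For the new vertices distinctness
  comes from \<open>d_ge_2\<close>.\<close>

lemma rotation_system_altan: "rotation_system A R"
  unfolding rotation_system_def
proof
  fix x assume x: "x \<in> verts A"
  show "distinct (R x) \<and> set (R x) = {y. (x, y) \<in> darts A}"
  proof (cases x)
    case (Old v)
    obtain p q r where nbrs: "lattice_nbrs v = [p, q, r]"
      by (auto simp: lattice_nbrs_def Let_def)
    have dist: "p \<noteq> q" "p \<noteq> r" "q \<noteq> r" using distinct_lattice_nbrs[of v] nbrs by auto
    have R: "R x = concat (map (\<lambda>u. if {v, u} \<in> edges G then [Old u] else spokes_at v) [p, q, r])"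
      using R_Old[of v] Old nbrs by simp
    have darts: "{y. (x, y) \<in> darts A} =
        Old ` {u \<in> {p, q, r}. {v, u} \<in> edges G} \<union> set (spokes_at v)"
      using coronoid_dart_iff[OF K(1), of v] nbrs unfolding Old set_spokes_at by (auto simp: darts_Old)
    show ?thesis
    proof (cases "v \<in> set vs")
      case True
      then obtain i where i: "i < d" "v = vs ! i" by (metis in_set_conv_nth length_vs(1))
      have "degree G v = 2" using True by (auto simp: vs_def deg2_vertices_def)
      then have "length (filter (\<lambda>u. {v, u} \<in> edges G) [p, q, r]) = 2"
        using degree_coronoid[OF K(1), of v] nbrs by simp
      then show ?thesis
        unfolding R darts using spokes_at_vs[OF i(1)] dist unfolding i(2)[symmetric]
        by (auto split: if_splits)
    next
      case False
      then show ?thesis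
        unfolding R darts using spokes_at_empty[OF False] dist by auto
    qed
  next
    case (W i)
    then have "i < d" using x by (auto simp: altan_eq)
    then show ?thesis
      using pred_mod_neq[of i] W by (auto simp: R_W darts_W)
  next
    case (X i)
    then have "i < d" using x by (auto simp: altan_eq)
    then show ?thesis
      using Suc_mod_neq[of i] X by (auto simp: R_X darts_X)
  qed
qed

text \<open>The two orders in \<open>R_W\<close> are mirror images, so with the flag
  \<open>hl\<close> the turns read the same in both cases. The first two belong to new faces, the
  third to the face on the other side of the new cycle.\<close>

lemma turn_W:
  assumes "i < d"
  shows "turn hl R (X i) (W i) (Old (vs ! i))"
    "turn hl R (Old (vs ! i)) (W i) (X ((i + d - 1) mod d))"
    "turn hl R (X ((i + d - 1) mod d)) (W i) (X i)"
  using pred_mod_neq[OF assms] by (auto simp: turn_def R_W cyc_next_def)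

lemma turn_X:
  assumes "i < d"
  shows "turn hl R (W i) (X i) (W (Suc i mod d))" "turn hl R (W (Suc i mod d)) (X i) (W i)"
  using Suc_mod_neq[OF assms] by (auto simp: turn_def R_X cyc_next_def)

text \<open>At degree 3 the third edge points away from the hole, so nothing separates the two
  perimeter edges on the side of the hole.\<close>

lemma turn_path:
  assumes "degree G (C (Suc k)) = 3"
  shows "turn hl R (Old (C k)) (Old (C (Suc k))) (Old (C (Suc (Suc k))))"
proof -
  let ?v = "C (Suc k)" and ?p = "C k" and ?q = "C (Suc (Suc k))"
  obtain r where E: "{?v, ?p} \<in> edges G" "{?v, ?q} \<in> edges G"
    and deg: "degree G ?v = (if {?v, r} \<in> edges G then 3 else 2)"
    and r: "hl = ({?v, r} \<in> edges G) \<Longrightarrow> cyclic_order (lattice_nbrs ?v) ?q ?p r"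
      "hl \<noteq> ({?v, r} \<in> edges G) \<Longrightarrow> cyclic_order (lattice_nbrs ?v) ?q r ?p"
    using ex_local_picture[of k] unfolding local_picture_def Let_def if_bool_eq_conj by blast
  have rE: "{?v, r} \<in> edges G" using deg assms by (simp split: if_splits)
  show ?thesis
  proof (cases hl)
    case True
    then have o: "cyclic_order (lattice_nbrs ?v) ?q ?p r" using r rE by blast
    then have "distinct [?q, ?p, r]" using distinct_lattice_nbrs[of ?v] by auto
    moreover have "cyclic_order (R (Old ?v)) (Old ?q) (Old ?p) (Old r)"
      using o E rE unfolding R_Old by auto
    ultimately show ?thesis
      using True cyc_next_3[of "R (Old ?v)" "Old ?q" "Old ?p" "Old r"] by (simp add: turn_def)
  next
    case False
    then have o: "cyclic_order (lattice_nbrs ?v) ?q r ?p" using r rE by blast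
    then have "distinct [?q, r, ?p]" using distinct_lattice_nbrs[of ?v] by auto
    moreover have "cyclic_order (R (Old ?v)) (Old ?q) (Old r) (Old ?p)"
      using o E rE unfolding R_Old by auto
    ultimately show ?thesis
      using False cyc_next_3[of "R (Old ?v)" "Old ?q" "Old r" "Old ?p"] by (simp add: turn_def)
  qed
qed

text \<open>The spoke fills the gap of the missing edge, which lies between the two perimeter edges
  on the side of the hole. The vertex is given as \<open>C (Suc k)\<close> because a predecessor is
  needed and \<open>pos i\<close> may be 0.\<close>

lemma turn_spoke:
  assumes "i < d" "C (Suc k) = vs ! i"
  shows "turn hl R (Old (C k)) (Old (vs ! i)) (W i)"
    "turn hl R (W i) (Old (vs ! i)) (Old (C (Suc (Suc k))))"
proof -
  let ?v = "C (Suc k)" and ?p = "C k" and ?q = "C (Suc (Suc k))"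
  obtain r where E: "{?v, ?p} \<in> edges G" "{?v, ?q} \<in> edges G"
    and deg: "degree G ?v = (if {?v, r} \<in> edges G then 3 else 2)"
    and r: "hl = ({?v, r} \<in> edges G) \<Longrightarrow> cyclic_order (lattice_nbrs ?v) ?q ?p r"
      "hl \<noteq> ({?v, r} \<in> edges G) \<Longrightarrow> cyclic_order (lattice_nbrs ?v) ?q r ?p"
    using ex_local_picture[of k] unfolding local_picture_def Let_def if_bool_eq_conj by blast
  have "degree G ?v = 2" using degree_block[OF assms(1), of 0] assms by (simp add: vs_nth)
  then have rE: "{?v, r} \<notin> edges G" using deg by (simp split: if_splits)
  have sp: "spokes_at ?v = [W i]" using spokes_at_vs[OF assms(1)] assms(2) by simp
  have pq: "?q \<noteq> ?p" using C_skip[of k] by simp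
  have "turn hl R (Old ?p) (Old ?v) (W i) \<and> turn hl R (W i) (Old ?v) (Old ?q)"
  proof (cases hl)
    case True
    then have "cyclic_order (lattice_nbrs ?v) ?q r ?p" using r rE by blast
    then have "cyclic_order (R (Old ?v)) (Old ?q) (W i) (Old ?p)"
      using E rE sp unfolding R_Old by auto
    then show ?thesis
      using True pq cyc_next_3[of "R (Old ?v)" "Old ?q" "W i" "Old ?p"] by (simp add: turn_def)
  next
    case False
    then have "cyclic_order (lattice_nbrs ?v) ?q ?p r" using r rE by blast
    then have "cyclic_order (R (Old ?v)) (Old ?q) (Old ?p) (W i)"
      using E rE sp unfolding R_Old by auto
    then show ?thesis
      using False pq cyc_next_3[of "R (Old ?v)" "Old ?q" "Old ?p" "W i"] by (simp add: turn_def)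
  qed
  then show "turn hl R (Old (C k)) (Old (vs ! i)) (W i)"
    "turn hl R (W i) (Old (vs ! i)) (Old (C (Suc (Suc k))))"
    by (simp_all add: assms(2))
qed

section \<open>The new faces\<close>

text \<open>The closed walk has length \<open>ls ! i + 5\<close>; the last branch unrolls it past its end.\<close>

definition new_walk :: "nat \<Rightarrow> nat \<Rightarrow> point altan_vertex" where
  "new_walk i k = (let l = ls ! i in
     if k \<le> l + 1 then Old (C (pos i + k))
     else if k = l + 2 then W (Suc i mod d)
     else if k = l + 3 then X i
     else if k = l + 4 then W i
     else Old (C (pos i + (k - (l + 5)))))"

definition new_face :: "nat \<Rightarrow> (point altan_vertex \<times> point altan_vertex) set" where
  "new_face i = (\<lambda>k. orient hl (new_walk i k) (new_walk i (Suc k))) ` {..<ls ! i + 5}"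

lemma new_walk_simps:
  "k \<le> ls ! i + 1 \<Longrightarrow> new_walk i k = Old (C (pos i + k))"
  "new_walk i (ls ! i + 2) = W (Suc i mod d)" "new_walk i (ls ! i + 3) = X i"
  "new_walk i (ls ! i + 4) = W i" "new_walk i (ls ! i + 5 + k) = Old (C (pos i + k))"
  by (simp_all add: new_walk_def Let_def)

lemma pred_mod_Suc: "i < d \<Longrightarrow> (Suc i mod d + d - 1) mod d = i"
  using Suc_mod_eq_iff[OF Suc_mod_d[of i], of i] by simp

lemma turn_new_walk:
  assumes i: "i < d" and k: "k < ls ! i + 5"
  shows "turn hl R (new_walk i k) (new_walk i (Suc k)) (new_walk i (Suc (Suc k)))"
proof -
  let ?l = "ls ! i" and ?j = "Suc i mod d"
  consider "k < ?l" | "k = ?l" | "k = ?l + 1" | "k = ?l + 2" | "k = ?l + 3" | "k = ?l + 4"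
    using k by linarith
  then show ?thesis
  proof cases
    case 1
    then have "degree G (C (Suc (pos i + k))) = 3"
      using degree_block[OF i, of "Suc k"] by simp
    then show ?thesis using 1 turn_path[of "pos i + k"] by (simp add: new_walk_simps(1))
  next
    case 2
    then show ?thesis
      using turn_spoke(1)[of ?j "pos i + ?l"] Suc_mod_d[of i] vs_next[OF i] new_walk_simps(2)[of i]
      by (simp add: new_walk_simps(1))
  next
    case 3
    then show ?thesis
      using turn_W(2)[OF Suc_mod_d[of i]] vs_next[OF i] new_walk_simps(2,3)[of i] pred_mod_Suc[OF i]
      by (simp add: new_walk_simps(1) eval_nat_numeral)
  next
    case 4
    then show ?thesis
      using turn_X(2)[OF i] new_walk_simps(2,3,4)[of i] by (simp add: eval_nat_numeral)
  next
    case 5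
    then show ?thesis
      using turn_W(1)[OF i] new_walk_simps(3,4)[of i] new_walk_simps(5)[of i 0] vs_nth[OF i]
      by (simp add: eval_nat_numeral)
  next
    case 6
    \<comment> \<open>The index is shifted by one period so that \<open>pos i = 0\<close> also has a
      predecessor.\<close>
    have n1: "Suc (n - 1 + pos i) = n + pos i" using cycle(1) by linarith
    have "C (Suc (n - 1 + pos i)) = vs ! i"
      unfolding n1 by (simp add: C_period vs_nth[OF i])
    then have "turn hl R (W i) (Old (vs ! i)) (Old (C (Suc (n + pos i))))"
      using turn_spoke(2)[OF i, of "n - 1 + pos i"] unfolding n1 by blast
    then have "turn hl R (W i) (Old (vs ! i)) (Old (C (Suc (pos i))))"
      using C_period[of "Suc (pos i)"] by simp
    then show ?thesis
      using 6 new_walk_simps(4)[of i] new_walk_simps(5)[of i 0] new_walk_simps(5)[of i 1] vs_nth[OF i]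
      by (simp add: eval_nat_numeral)
  qed
qed

lemma new_face_orbit:
  assumes "i < d"
  shows "orbit (face_step R) (orient hl (new_walk i 0) (new_walk i 1)) = new_face i"
  unfolding new_face_def
  using orbit_oriented_walk[of "ls ! i + 5" hl R "new_walk i"] turn_new_walk[OF assms]
    new_walk_simps(5)[of i 0] new_walk_simps(5)[of i 1] new_walk_simps(1)[of 0 i]
    new_walk_simps(1)[of 1 i] by simp

lemma new_face_in_faces:
  assumes "i < d"
  shows "new_face i \<in> faces A R"
proof -
  have "0 < n" "1 < n" using cycle(1) by linarith+
  then have "C (pos i) \<noteq> C (Suc (pos i))"
    using inj_onD[OF C_shift_inj[of "pos i"], of 0 1] by auto
  then have "(C (pos i), C (Suc (pos i))) \<in> darts G"
    using C_edge[of "pos i"] by (simp add: darts_def boundary_graph_def)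
  then have "(new_walk i 0, new_walk i 1) \<in> darts A"
    by (simp add: new_walk_simps(1) darts_Old)
  then have "orient hl (new_walk i 0) (new_walk i 1) \<in> darts A"
    by (simp add: orient_def darts_sym)
  then show ?thesis unfolding faces_def using new_face_orbit[OF assms] by blast
qed

text \<open>Only the perimeter part of the walk could repeat a vertex. It has
  \<open>ls ! i + 2\<close> vertices, which are distinct as long as they do not exceed one
  period.\<close>

lemma card_new_face:
  assumes "i < d"
  shows "card (new_face i) = ls ! i + 5"
  unfolding new_face_def
proof (rule card_oriented_walk, rule linorder_inj_onI)
  let ?l = "ls ! i" and ?j = "Suc i mod d"
  have "vs ! i \<noteq> vs ! ?j"
    using distinct_vs nth_eq_iff_index_eq[of vs i ?j] assms Suc_mod_d Suc_mod_neq[OF assms] by auto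
  \<comment> \<open>A block filling the whole period would make two consecutive spokes start at the
    same vertex.\<close>
  then have "C (pos i + Suc ?l) \<noteq> C (pos i + n)"
    using vs_next[OF assms] vs_nth[OF assms] C_period[of "pos i"] by (simp add: add.commute)
  then have "Suc ?l \<noteq> n" by metis
  moreover have "Suc ?l \<le> n"
    using block_pos_less[OF assms, of "?l"] length_c by simp
  ultimately have l: "Suc ?l < n" by simp
  fix a b assume ab: "a < b" "a \<in> {..<?l + 5}" "b \<in> {..<?l + 5}"
  show "new_walk i a \<noteq> new_walk i b"
  proof (cases "b \<le> ?l + 1")
    case True
    then have "C (pos i + a) \<noteq> C (pos i + b)"
      using inj_onD[OF C_shift_inj[of "pos i"], of a b] l ab(1) by auto
    then show ?thesis using True ab(1) by (simp add: new_walk_simps(1))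
  next
    case False
    then consider "b = ?l + 2" | "b = ?l + 3" | "b = ?l + 4" using ab by fastforce
    then show ?thesis
      by cases (use ab Suc_mod_neq[OF assms] in \<open>auto simp: new_walk_def Let_def\<close>)
  qed
qed (simp add: linorder_linear)

lemma mem_new_face:
  assumes "k < ls ! i + 5"
  shows "orient hl (new_walk i k) (new_walk i (Suc k)) \<in> new_face i"
  using assms unfolding new_face_def by blast

lemma new_face_darts:
  assumes "i < d"
  shows "orient hl (X i) (W i) \<in> new_face i" "orient hl (W (Suc i mod d)) (X i) \<in> new_face i"
    "orient hl (W i) (Old (vs ! i)) \<in> new_face i"
    "orient hl (Old (vs ! (Suc i mod d))) (W (Suc i mod d)) \<in> new_face i"
  using mem_new_face[of "ls ! i + 3" i] mem_new_face[of "ls ! i + 2" i]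
    mem_new_face[of "ls ! i + 4" i] mem_new_face[of "ls ! i + 1" i]
    new_walk_simps(2,3,4)[of i] new_walk_simps(1)[of "ls ! i + 1" i] new_walk_simps(5)[of i 0]
    vs_next[OF assms] vs_nth[OF assms]
  by (simp_all add: eval_nat_numeral)

lemma is_new_face_new_face:
  assumes "i < d"
  shows "is_new_face K c i (new_face i)"
  using new_face_in_faces[OF assms] new_face_darts[OF assms]
  by (auto simp: is_new_face_def Let_def spoke_def vs_def[symmetric] mem_face_edges orient_def
      split: if_splits)

text \<open>The darts of the new cycle opposite to those in the new faces. Closure under
  \<open>face_step\<close> alone bounds the face through any of them; that they form a single orbit
  is not shown.\<close>

definition new_cycle_face :: "(point altan_vertex \<times> point altan_vertex) set" where
  "new_cycle_face = (\<lambda>i. orient hl (W i) (X i)) ` {..<d} \<union>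
     (\<lambda>i. orient hl (X i) (W (Suc i mod d))) ` {..<d}"

lemma new_cycle_face_closed:
  assumes "y \<in> new_cycle_face"
  shows "face_step R y \<in> new_cycle_face"
proof -
  have fwd: "face_step R (orient hl (W i) (X i)) = orient hl (X i) (W (Suc i mod d))"
    "face_step R (orient hl (X i) (W (Suc i mod d))) =
       orient hl (W (Suc i mod d)) (X (Suc i mod d))" if "\<not> hl" "i < d" for i
    using that face_step_orient[OF turn_X(1)[OF that(2)]] face_step_orient[OF turn_W(3)[OF Suc_mod_d[of i]]]
    by (simp_all only: if_False pred_mod_Suc)
  \<comment> \<open>With the hole on the left, \<open>face_step\<close> runs against the order of
    the indices, so the darts are visited backwards.\<close>
  have bwd: "face_step R (orient hl (X i) (W (Suc i mod d))) = orient hl (W i) (X i)"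
    "face_step R (orient hl (W (Suc i mod d)) (X (Suc i mod d))) =
       orient hl (X i) (W (Suc i mod d))" if "hl" "i < d" for i
    using that face_step_orient[OF turn_X(1)[OF that(2)]] face_step_orient[OF turn_W(3)[OF Suc_mod_d[of i]]]
    by (simp_all only: if_True pred_mod_Suc)
  have surj: "\<exists>k<d. i = Suc k mod d" if "i < d" for i
    using Suc_mod_eq_iff[OF that pred_mod_d] pred_mod_d by metis
  from assms consider i where "i < d" "y = orient hl (W i) (X i)"
    | i where "i < d" "y = orient hl (X i) (W (Suc i mod d))"
    unfolding new_cycle_face_def by blast
  then show ?thesis
  proof cases
    case 1
    obtain k where k: "k < d" "i = Suc k mod d" using surj[OF 1(1)] by blast
    then have "face_step R y = orient hl (X i) (W (Suc i mod d)) \<or>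
        face_step R y = orient hl (X k) (W (Suc k mod d))"
      using 1 fwd(1)[of i] bwd(2)[of k] by blast
    then show ?thesis using 1(1) k(1) unfolding new_cycle_face_def by blast
  next
    case 2
    then have "face_step R y = orient hl (W (Suc i mod d)) (X (Suc i mod d)) \<or>
        face_step R y = orient hl (W i) (X i)"
      using fwd(2)[of i] bwd(1)[of i] by blast
    then show ?thesis using 2(1) Suc_mod_d[of i] unfolding new_cycle_face_def by blast
  qed
qed

text \<open>The edge \<open>{W i, X i}\<close> leaves two possible darts in \<open>F\<close>. One
  lies in \<open>new_face i\<close> and so determines \<open>F\<close>; the other would confine
  \<open>F\<close> to \<open>new_cycle_face\<close>, contradicting the spoke in
  \<open>F\<close>.\<close>

lemma is_new_face_unique:
  assumes i: "i < d" and F: "is_new_face K c i F"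
  shows "F = new_face i"
proof -
  have face: "F \<in> faces A R" and wx: "{W i, X i} \<in> face_edges F"
    and spoke: "{Old (vs ! i), W i} \<in> face_edges F"
    using F by (simp_all add: is_new_face_def Let_def spoke_def vs_def)
  note orbit = face_eq_orbit[OF wf_altan rotation_system_altan finite_darts_altan]
  have "orient hl (X i) (W i) \<in> F \<or> orient hl (W i) (X i) \<in> F"
    using wx by (auto simp: mem_face_edges orient_def)
  then show ?thesis
  proof
    assume "orient hl (X i) (W i) \<in> F"
    then show ?thesis
      using orbit[OF face] orbit[OF new_face_in_faces[OF i] new_face_darts(1)[OF i]] by blast
  next
    assume x: "orient hl (W i) (X i) \<in> F"
    have "orient hl (W i) (X i) \<in> new_cycle_face" using i by (simp add: new_cycle_face_def)
    then have "F \<subseteq> new_cycle_face"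
      using orbit[OF face x] orbit_subset_closed[of _ new_cycle_face "face_step R"] new_cycle_face_closed by blast
    then have False using spoke by (auto simp: mem_face_edges new_cycle_face_def orient_def split: if_splits)
    then show ?thesis ..
  qed
qed

text \<open>The degrees are the lengths of the rotation lists, by
  \<open>degree_rotation\<close>.\<close>

lemma degree_sequence_new_cycle:
  "degree_sequence A (altan_new_cycle G c) = concat (replicate d [3, 2])"
proof -
  have "degree A (W i) = 3" "degree A (X i) = 2" if "i < d" for i
    using that degree_rotation[OF wf_altan rotation_system_altan]
    by (simp_all add: altan_eq R_W R_X)
  then have "concat (map (\<lambda>i. [degree A (W i), degree A (X i)]) [0..<d]) =
      concat (map (\<lambda>i. [3, 2]) [0..<d])"
    by (intro arg_cong[where f = concat] map_cong) auto
  then show ?thesis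
    by (simp add: degree_sequence_def altan_new_cycle_def map_concat comp_def map_replicate_const)
qed

end

theorem theorem5p2:
  fixes K :: "point set" and c :: "point list" and ls :: "nat list"
  assumes "coronoid K" and "nondegenerate K"
    and "perimeter K c"
    and "degree_sequence (coronoid_graph K) c = concat (map (\<lambda>l. 2 # replicate l 3) ls)"
  shows "(\<forall>i < length ls.
            (\<exists>!F. is_new_face K c i F) \<and>
            (\<forall>F. is_new_face K c i F \<longrightarrow> face_degree F = ls ! i + 5)) \<and>
         bbc (altan (coronoid_graph K) c) (altan_new_cycle (coronoid_graph K) c) =
           cyclic_code (concat (replicate (length ls) [3, 2]))"
proof -
  interpret coded_perimeter K c ls
    using assms by unfold_locales (simp_all add: coronoid_def)
  show ?thesis
    using is_new_face_new_face is_new_face_unique card_new_face degree_sequence_new_cycle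
    unfolding face_degree_def bbc_def by metis
qed

end
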